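(* Let $n\ge1$, $0<\lambda<1$, $p>1$, let $w$ be a non-negative locally integrable function on $\mathbb{R}^n$, and let $\Omega\subset\mathbb{R}^n$ be an arbitrary nonempty closed set. Given $0<r_1<r_2<\infty$, define $$\mathcal{W}_{r_1,r_2}:=\{Q\in\mathcal{Q}: r_1\,\mathrm{diam}\,Q\le \mathrm{dist}(Q,\Omega)\le r_2\,\mathrm{diam}\,Q\}.$$ Then the Hardy--Littlewood maximal operator $M$ is bounded on $\mathcal{M}^p_{\lambda,\mathcal{W}_{r_1,r_2}}(w)$ if and only if the $A_{\mathcal{M}^p_{\lambda,\mathcal{W}_{r_1,r_2}}(w)}$ condition holds.
   Context: $\mathcal{Q}$ denotes the family of all cubes in $\mathbb{R}^n$ with sides parallel to the axes; $\langle f\rangle_Q=\frac{1}{|Q|}\int_Q f$. The Hardy--Littlewood maximal operator is $Mf(x)=\sup_{Q\ni x,\,Q\in\mathcal{Q}}\langle |f|\rangle_Q$. For a family $\mathcal{F}\subset\mathcal{Q}$, the weighted Morrey space $\mathcal{M}^p_{\lambda,\mathcal{F}}(w)$ consists of measurable $f$ with finite norm $$\|f\|_{\mathcal{M}^p_{\lambda,\mathcal{F}}(w)}:=\sup_{Q\in\mathcal{F}}\Big(\frac{1}{|Q|^{\lambda}}\int_Q|f|^pw\Big)^{1/p}.$$ $M$ is bounded on a space $X$ with norm $\|\cdot\|_X$ if there is $C>0$ with $\|Mf\|_X\le C\|f\|_X$ for all $f$. The $A_X$ condition means: there exists $C>0$ such that for every locally integrable $f$ and every cube $Q\in\mathcal{Q}$,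 $\langle |f|\rangle_Q\,\|\chi_Q\|_X\le C\|f\chi_Q\|_X$. *)

theory Defs
  imports "HOL-Analysis.Analysis"
begin

text \<open>Positive real powers of extended non-negative reals (exponent assumed positive):
  \<open>\<infinity> powr r = \<infinity>\<close>, finite values as usual.\<close>
definition enn_powr :: "ennreal \<Rightarrow> real \<Rightarrow> ennreal" where
  "enn_powr x r = (if x = top then top else ennreal (enn2real x powr r))"

definition cubes :: "'a::euclidean_space set set" where
  "cubes = {cbox a (a + l *\<^sub>R One) | a l. l > 0}"

definition avg :: "'a::euclidean_space set \<Rightarrow> ('a \<Rightarrow> ennreal) \<Rightarrow> ennreal" where
  "avg Q g = ennreal (1 / measure lebesgue Q) * (\<integral>\<^sup>+ y\<in>Q. g y \<partial>lebesgue)"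

definition maximal :: "('a::euclidean_space \<Rightarrow> ennreal) \<Rightarrow> 'a \<Rightarrow> ennreal" where
  "maximal g x = (SUP Q\<in>{Q\<in>cubes. x \<in> Q}. avg Q g)"

definition morrey_norm ::
  "real \<Rightarrow> real \<Rightarrow> 'a::euclidean_space set set \<Rightarrow> ('a \<Rightarrow> real) \<Rightarrow> ('a \<Rightarrow> ennreal) \<Rightarrow> ennreal" where
  "morrey_norm p lam F w g =
     (SUP Q\<in>F. enn_powr (ennreal (1 / (measure lebesgue Q powr lam)) *
                 (\<integral>\<^sup>+ x\<in>Q. enn_powr (g x) p * ennreal (w x) \<partial>lebesgue)) (1 / p))"

definition whitney_family :: "'a::euclidean_space set \<Rightarrow> real \<Rightarrow> real \<Rightarrow> 'a set set" where
  "whitney_family \<Omega> r1 r2 =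
     {Q\<in>cubes. r1 * diameter Q \<le> setdist Q \<Omega> \<and> setdist Q \<Omega> \<le> r2 * diameter Q}"

definition locally_integrable :: "('a::euclidean_space \<Rightarrow> real) \<Rightarrow> bool" where
  "locally_integrable f \<longleftrightarrow> (\<forall>K. compact K \<longrightarrow> set_integrable lebesgue K f)"

text \<open>Boundedness of \<open>M\<close> on the Morrey space (for all measurable \<open>f\<close>; functions
  outside the space have infinite norm and satisfy the inequality trivially).\<close>
definition maximal_bounded :: "real \<Rightarrow> real \<Rightarrow> 'a::euclidean_space set set \<Rightarrow> ('a \<Rightarrow> real) \<Rightarrow> bool" where
  "maximal_bounded p lam F w \<longleftrightarrow>
     (\<exists>C>0. \<forall>f \<in> borel_measurable lebesgue.
        morrey_norm p lam F w (maximal (\<lambda>x. ennreal \<bar>f x\<bar>))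
          \<le> ennreal C * morrey_norm p lam F w (\<lambda>x. ennreal \<bar>f x\<bar>))"

definition A_morrey :: "real \<Rightarrow> real \<Rightarrow> 'a::euclidean_space set set \<Rightarrow> ('a \<Rightarrow> real) \<Rightarrow> bool" where
  "A_morrey p lam F w \<longleftrightarrow>
     (\<exists>C>0. \<forall>f Q. locally_integrable f \<longrightarrow> Q \<in> cubes \<longrightarrow>
        avg Q (\<lambda>x. ennreal \<bar>f x\<bar>) * morrey_norm p lam F w (indicator Q)
          \<le> ennreal C * morrey_norm p lam F w (\<lambda>x. ennreal \<bar>f x * indicator Q x\<bar>))"

end

theory Submission
  imports Defs
begin

text \<open>
  Every cube of the Whitney family \<open>F\<close> has size comparable to its distance to \<open>\<Omega>\<close>. Hence for a cube \<open>Q\<close>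
  that is small compared with its distance to \<open>\<Omega>\<close>, the Morrey norm of a function supported in \<open>Q\<close> is, up
  to constants, a power of \<open>|Q'|\<close> (for any \<open>Q' \<in> F\<close> meeting \<open>Q\<close>) times its \<open>L\<^sup>p(w)\<close> norm, and the
  condition \<open>A_morrey\<close> becomes the Muckenhoupt condition \<open>A\<^sub>p\<close> on all such cubes, with a uniform constant.

  For the bound on \<open>M f\<close> over \<open>P \<in> F\<close>, cubes meeting \<open>P\<close> that are small compared with their distance to
  \<open>\<Omega>\<close> are handled by Muckenhoupt's theorem, applied to \<open>f\<close> cut off to a neighbourhood of \<open>P\<close> which is covered by a
  bounded number of cubes of \<open>F\<close> of size comparable to \<open>P\<close>. A cube that is not small can be dilated by
  a fixed factor to contain \<open>P\<close>, and then \<open>A_morrey\<close> on the dilated cube bounds the average directly.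

  Muckenhoupt's theorem is proved by Lerner's argument: with \<open>\<sigma> = w powr (- 1 / (p - 1))\<close>, the maximal
  function \<open>(M f) powr (p - 1)\<close> is dominated by \<open>M\<^sub>w ((M\<^sub>\<sigma> (f / \<sigma>)) powr (p - 1) / w)\<close>, and the weighted maximal operators are
  bounded by Vitali covering and interpolation, since \<open>w\<close> and \<open>\<sigma>\<close> are doubling on the cubes in question.
\<close>

subsection \<open>Powers of extended non-negative reals\<close>

text \<open>Obstacle: \<open>w\<close> is known to be doubling only on cubes that are small compared
  with their distance to \<open>\<Omega>\<close>, so the maximal theorem cannot be run over all
  cubes of the space. It is therefore proved for an arbitrary countable family of cubes, with A_p
  assumed just for each member and for its dilate by \<open>5 * sqrt n\<close> (\<open>n\<close> the
  dimension), the factor 5 coming from Vitali and \<open>sqrt n\<close> from enclosing a cube in a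
  ball. Lerner's argument fits this setting because its pointwise estimate treats one cube at a
  time; the family enters only through the two weighted maximal functions.

  The exponent \<open>lam\<close> disappears from the local condition by cancellation: for small
  \<open>Q\<close> the volume power occurs once in the norm of the indicator and once, inverted, in
  the norm of the test function. What remains is a ratio of volumes of Whitney cubes meeting
  \<open>Q\<close>, bounded in terms of \<open>r1\<close>, \<open>r2\<close> and \<open>n\<close>.

  Large cubes contribute one number on \<open>P\<close>, the supremum of their averages, so they
  need only the measure of \<open>P\<close>. Infinite averages are legitimate values throughout,
  which is why several arguments truncate first and then take a supremum.\<close>

lemma enn_powr_0 [simp]: "enn_powr 0 r = 0"
  by (simp add: enn_powr_def)

lemma enn_powr_top [simp]: "enn_powr top r = top"
  by (simp add: enn_powr_def)

lemma enn_powr_ennreal: "0 \<le> x \<Longrightarrow> enn_powr (ennreal x) r = ennreal (x powr r)"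
  by (simp add: enn_powr_def)

lemma enn_powr_1 [simp]: "enn_powr x 1 = x"
  by (cases x) (auto simp: enn_powr_ennreal)

lemma enn_powr_one [simp]: "enn_powr 1 r = 1"
  using enn_powr_ennreal[of 1 r] by simp

lemma enn_powr_mono:
  assumes "x \<le> y" "0 \<le> r"
  shows "enn_powr x r \<le> enn_powr y r"
  using assms
  by (cases x; cases y) (auto simp: enn_powr_ennreal powr_mono2 top_unique ennreal_leI)

lemma enn_powr_mult:
  assumes "0 < r"
  shows "enn_powr (x * y) r = enn_powr x r * enn_powr y r"
proof (cases "x = top \<or> y = top")
  case True
  have z: "enn_powr z r = 0 \<longleftrightarrow> z = 0" for z
    by (cases z) (auto simp: enn_powr_ennreal)
  from True show ?thesis
    by (cases "x = 0 \<or> y = 0") (auto simp: ennreal_mult_top ennreal_top_mult z)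
next
  case False
  then obtain a b where "x = ennreal a" "0 \<le> a" "y = ennreal b" "0 \<le> b"
    by (cases x; cases y) auto
  then show ?thesis
    by (simp add: enn_powr_ennreal powr_mult flip: ennreal_mult)
qed

lemma enn_powr_powr: "enn_powr (enn_powr x r) s = enn_powr x (r * s)"
  by (cases x) (auto simp: enn_powr_ennreal powr_powr)

lemma enn_powr_add:
  assumes "0 < r" "0 < s"
  shows "enn_powr x (r + s) = enn_powr x r * enn_powr x s"
  by (cases x) (auto simp: enn_powr_ennreal powr_add ennreal_mult)

text \<open>The powers \<open>r\<close> and \<open>1 / r\<close> form an adjunction. This gives
  commutation with suprema and lets the outer exponent \<open>1 / p\<close> of the Morrey norm be
  moved across an inequality.\<close>

lemma enn_powr_le_iff:
  assumes "0 < r"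
  shows "enn_powr x r \<le> y \<longleftrightarrow> x \<le> enn_powr y (1 / r)"
  using enn_powr_mono[of "enn_powr x r" y "1 / r"] enn_powr_mono[of x "enn_powr y (1 / r)" r] assms
  by (auto simp: enn_powr_powr)

lemma enn_powr_SUP:
  assumes "0 < r"
  shows "enn_powr (SUP i\<in>I. f i) r = (SUP i\<in>I. enn_powr (f i) r)"
proof (rule antisym)
  show "enn_powr (SUP i\<in>I. f i) r \<le> (SUP i\<in>I. enn_powr (f i) r)"
    unfolding enn_powr_le_iff[OF assms]
    by (rule SUP_least, rule enn_powr_le_iff[OF assms, THEN iffD1], rule SUP_upper)
  show "(SUP i\<in>I. enn_powr (f i) r) \<le> enn_powr (SUP i\<in>I. f i) r"
    using assms by (intro SUP_least enn_powr_mono SUP_upper) auto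
qed

lemma enn_powr_eq_0_iff [simp]: "enn_powr x r = 0 \<longleftrightarrow> x = 0"
  by (cases x) (auto simp: enn_powr_ennreal)

lemma borel_measurable_enn_powr [measurable]:
  assumes [measurable]: "f \<in> borel_measurable M"
  shows "(\<lambda>x. enn_powr (f x) r) \<in> borel_measurable M"
  unfolding enn_powr_def by measurable

lemma ennreal_eq_topI: "(\<And>N::nat. ennreal (real N) \<le> y) \<Longrightarrow> y = top"
  by (metis ennreal_Ex_less_of_nat ennreal_of_nat_eq_real_of_nat leD not_less top.not_eq_extremum)

text \<open>Integration of the derivative of \<open>t powr r\<close> up to \<open>y\<close>. The
  value \<open>y = top\<close> is included because the maximal functions it is applied to may be
  infinite.\<close>

lemma layer_cake:
  assumes "0 < r"
  shows "enn_powr y r =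
    (\<integral>\<^sup>+t. ennreal (r * t powr (r - 1)) * indicator {t. 0 < t \<and> ennreal t < y} t \<partial>lborel)"
proof -
  have fin: "enn_powr (ennreal c) r =
    (\<integral>\<^sup>+t. ennreal (r * t powr (r - 1)) * indicator {t. 0 < t \<and> ennreal t < ennreal c} t \<partial>lborel)"
    if c: "0 \<le> c" for c
  proof -
    have "((\<lambda>x. r * x powr (r - 1)) has_integral r * (c powr r / r)) {0..c}"
      using has_integral_powr_from_0[of "r - 1" c] assms c by (intro has_integral_mult_right) auto
    then have "(\<integral>\<^sup>+t. ennreal (r * t powr (r - 1)) * indicator {0..c} t \<partial>lborel) = ennreal (c powr r)"
      using assms by (subst nn_integral_has_integral_lebesgue'[where I = "c powr r"]) auto
    moreover have "(\<integral>\<^sup>+t. ennreal (r * t powr (r - 1)) * indicator {t. 0 < t \<and> ennreal t < ennreal c} t \<partial>lborel)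
       = (\<integral>\<^sup>+t. ennreal (r * t powr (r - 1)) * indicator {0..c} t \<partial>lborel)"
    proof (rule nn_integral_cong_AE)
      \<comment> \<open>At \<open>t = 0\<close> both integrands vanish since
        \<open>0 powr (r - 1) = 0\<close>, so only the endpoint \<open>c\<close> has to be
        discarded.\<close>
      have "AE t in lborel. t \<noteq> c"
        using AE_lborel_singleton by blast
      then show "AE t in lborel. ennreal (r * t powr (r - 1)) * indicator {t. 0 < t \<and> ennreal t < ennreal c} t
          = ennreal (r * t powr (r - 1)) * indicator {0..c} t"
        by eventually_elim (auto simp: indicator_def ennreal_less_iff)
    qed
    ultimately show ?thesis
      using c by (simp add: enn_powr_ennreal)
  qed
  show ?thesis
  proof (cases y)
    case (real c)
    then show ?thesis using fin by simp
  next
    case top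
    have "(\<integral>\<^sup>+t. ennreal (r * t powr (r - 1)) * indicator {t. 0 < t \<and> ennreal t < y} t \<partial>lborel) = top"
    proof (rule ennreal_eq_topI)
      fix N :: nat
      \<comment> \<open>Every finite level bounds the integral from below; the level is chosen so
        that its \<open>r\<close>-th power is \<open>N\<close>.\<close>
      have "ennreal (real N) = enn_powr (ennreal (real N powr (1 / r))) r"
        using assms by (simp add: enn_powr_ennreal powr_powr)
      also have "\<dots> \<le> (\<integral>\<^sup>+t. ennreal (r * t powr (r - 1)) * indicator {t. 0 < t \<and> ennreal t < y} t \<partial>lborel)"
        unfolding fin[OF powr_ge_zero] top
        by (intro nn_integral_mono) (auto simp: indicator_def)
      finally show "ennreal (real N) \<le> \<dots>" .
    qed
    then show ?thesis using top by simp
  qed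
qed

subsection \<open>Weighted maximal functions\<close>

text \<open>Centre and half side are the parameters, so that a dilate keeps its centre and
  \<open>cball a l\<close> is the inscribed ball.\<close>

definition qcube :: "'a::euclidean_space \<Rightarrow> real \<Rightarrow> 'a set" where
  "qcube a l = cbox (a - l *\<^sub>R One) (a + l *\<^sub>R One)"

text \<open>The uncentred maximal function over the cubes listed in \<open>J\<close>. Indexing by
  pairs makes measurability a matter of countability of \<open>J\<close>. A cube of measure 0 or
  \<open>top\<close> contributes 0, by the conventions for division in
  \<open>ennreal\<close>.\<close>

definition wmax :: "'a::euclidean_space measure \<Rightarrow> ('a \<times> real) set \<Rightarrow> ('a \<Rightarrow> ennreal) \<Rightarrow> 'a \<Rightarrow> ennreal" where
  "wmax \<mu> J g x = (SUP (a, l)\<in>J. indicator (qcube a l) x *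
     ((\<integral>\<^sup>+y\<in>qcube a l. g y \<partial>\<mu>) / emeasure \<mu> (qcube a l)))"

lemma mem_qcube: "x \<in> qcube a l \<longleftrightarrow> (\<forall>i\<in>Basis. \<bar>x \<bullet> i - a \<bullet> i\<bar> \<le> l)"
  by (auto simp: qcube_def mem_box inner_diff_left inner_add_left abs_le_iff algebra_simps)

lemma qcube_sets [measurable, simp]: "qcube a l \<in> sets borel"
  by (simp add: qcube_def)

lemma qcube_sets_lebesgue [measurable, simp]: "qcube a l \<in> sets lebesgue"
  by (simp add: qcube_def)

lemma qcube_subset_cball:
  fixes a :: "'a::euclidean_space"
  shows "qcube a l \<subseteq> cball a (sqrt (real DIM('a)) * l)"
proof
  fix x assume x: "x \<in> qcube a l"
  have l: "0 \<le> l"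
    using x SOME_Basis by (fastforce simp: mem_qcube)
  have "dist a x \<le> sqrt (\<Sum>i\<in>(Basis::'a set). l\<^sup>2)"
    unfolding euclidean_dist_l2[of a x] L2_set_def
    using x by (intro real_sqrt_le_mono sum_mono power_mono) (auto simp: mem_qcube dist_real_def abs_minus_commute)
  also have "\<dots> = sqrt (real DIM('a)) * l"
    using l by (simp add: real_sqrt_mult)
  finally show "x \<in> cball a (sqrt (real DIM('a)) * l)"
    by simp
qed

lemma cball_subset_qcube: "cball a r \<subseteq> qcube a r"
proof
  fix x assume "x \<in> cball a r"
  then have "norm (x - a) \<le> r"
    by (simp add: dist_norm norm_minus_commute)
  then show "x \<in> qcube a r"
    using Basis_le_norm[of _ "x - a"] by (fastforce simp: mem_qcube inner_diff_left)
qed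

lemma borel_measurable_wmax:
  assumes "countable J" and [measurable_cong]: "sets \<mu> = sets lebesgue"
  shows "wmax \<mu> J g \<in> borel_measurable \<mu>"
proof -
  have [measurable]: "qcube a l \<in> sets \<mu>" for a l
    using assms(2) by simp
  show ?thesis
    unfolding wmax_def[abs_def] using assms(1)
    by (intro borel_measurable_SUP) (auto simp: split_beta)
qed

text \<open>Vitali's lemma concerns balls, so each cube with average above \<open>t\<close> is
  enclosed in the ball of radius \<open>sqrt n * l\<close>. Disjointness of the selected balls
  passes to the cubes inside them, and the balls enlarged 5 times are paid for by the doubling
  hypothesis. The bound \<open>B\<close> is there because the lemma requires bounded radii.\<close>

lemma wmax_weak_type:
  fixes \<mu> :: "'a::euclidean_space measure"
  assumes J: "countable J" and \<mu>: "sets \<mu> = sets lebesgue"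
    and dbl: "\<And>a l. (a, l) \<in> J \<Longrightarrow> 0 < l \<and> l \<le> B \<and>
        emeasure \<mu> (cball a (5 * (sqrt (real DIM('a)) * l))) \<le> K * emeasure \<mu> (qcube a l)"
    and g: "g \<in> borel_measurable \<mu>"
  shows "t * emeasure \<mu> {x. t < wmax \<mu> J g x} \<le> K * (\<integral>\<^sup>+y. g y \<partial>\<mu>)"
proof -
  note [measurable_cong] = \<mu>
  have [measurable]: "qcube a l \<in> sets \<mu>" "cball a l \<in> sets \<mu>" for a l
    using \<mu> by simp_all
  define s where "s = sqrt (real DIM('a))"
  have s: "0 < s" by (simp add: s_def)
  define J' where "J' = {(a, l)\<in>J. t < (\<integral>\<^sup>+y\<in>qcube a l. g y \<partial>\<mu>) / emeasure \<mu> (qcube a l)}"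
  have sub: "{x. t < wmax \<mu> J g x} \<subseteq> (\<Union>j\<in>J'. cball (fst j) (s * snd j))"
  proof
    fix x assume "x \<in> {x. t < wmax \<mu> J g x}"
    then obtain a l where al: "(a, l) \<in> J" "t < indicator (qcube a l) x *
        ((\<integral>\<^sup>+y\<in>qcube a l. g y \<partial>\<mu>) / emeasure \<mu> (qcube a l))"
      by (auto simp: wmax_def less_SUP_iff)
    then have "x \<in> qcube a l"
      by (cases "x \<in> qcube a l") auto
    moreover from this have "(a, l) \<in> J'"
      using al by (auto simp: J'_def)
    ultimately
    show "x \<in> (\<Union>j\<in>J'. cball (fst j) (s * snd j))"
      using qcube_subset_cball[of a l] by (force simp: s_def)
  qed
  have r: "0 < s * snd j \<and> s * snd j \<le> s * B" if "j \<in> J'" for j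
    using that s dbl[of "fst j" "snd j"] by (auto simp: J'_def)
  obtain C where C: "countable C" "C \<subseteq> J'"
     "pairwise (\<lambda>i j. disjnt (cball (fst i) (s * snd i)) (cball (fst j) (s * snd j))) C"
     "{x. t < wmax \<mu> J g x} \<subseteq> (\<Union>i\<in>C. cball (fst i) (5 * (s * snd i)))"
    using Vitali_covering_lemma_cballs[OF sub r] by blast
  define Q where "Q j = qcube (fst j) (snd j)" for j :: "'a \<times> real"
  have [measurable]: "Q j \<in> sets \<mu>" for j
    by (simp add: Q_def)
  have disj: "disjnt (Q i) (Q j)" if "i \<in> C" "j \<in> C" "i \<noteq> j" for i j
    using C(3) that qcube_subset_cball[of "fst i" "snd i"] qcube_subset_cball[of "fst j" "snd j"]
    unfolding pairwise_def Q_def s_def disjnt_def by blast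
  \<comment> \<open>The sum over the countable set \<open>C\<close> is written as an integral over
    \<open>count_space C\<close>, which makes its interchange with the integral over
    \<open>\<mu>\<close> a single rule.\<close>
  have "emeasure \<mu> {x. t < wmax \<mu> J g x} \<le> (\<integral>\<^sup>+x. (\<integral>\<^sup>+i. indicator (cball (fst i) (5 * (s * snd i))) x \<partial>count_space C) \<partial>\<mu>)"
  proof -
    have "{x. t < wmax \<mu> J g x} \<in> sets \<mu>"
      using borel_measurable_less[OF borel_measurable_const borel_measurable_wmax[OF J \<mu>], of t g]
        sets_eq_imp_space_eq[OF \<mu>] by simp
    then have "emeasure \<mu> {x. t < wmax \<mu> J g x} = (\<integral>\<^sup>+x. indicator {x. t < wmax \<mu> J g x} x \<partial>\<mu>)"
      by simp
    also have "\<dots> \<le> (\<integral>\<^sup>+x. (\<integral>\<^sup>+i. indicator (cball (fst i) (5 * (s * snd i))) x \<partial>count_space C) \<partial>\<mu>)"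
    proof (rule nn_integral_mono)
      fix x
      show "indicator {x. t < wmax \<mu> J g x} x \<le> (\<integral>\<^sup>+i. indicator (cball (fst i) (5 * (s * snd i))) x \<partial>count_space C)"
      proof (cases "t < wmax \<mu> J g x")
        case True
        then obtain i where i: "i \<in> C" "x \<in> cball (fst i) (5 * (s * snd i))"
          using C(4) by blast
        then have "1 \<le> indicator (cball (fst i) (5 * (s * snd i))) x * emeasure (count_space C) {i}"
          by simp
        also have "\<dots> = (\<integral>\<^sup>+k. indicator (cball (fst i) (5 * (s * snd i))) x * indicator {i} k \<partial>count_space C)"
          using i by (subst nn_integral_cmult_indicator) auto
        also have "\<dots> \<le> (\<integral>\<^sup>+i. indicator (cball (fst i) (5 * (s * snd i))) x \<partial>count_space C)"
          by (intro nn_integral_mono) (auto simp: indicator_def)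
        finally show ?thesis using True by simp
      qed simp
    qed
    finally show ?thesis .
  qed
  also have "\<dots> = (\<integral>\<^sup>+i. emeasure \<mu> (cball (fst i) (5 * (s * snd i))) \<partial>count_space C)"
    using C(1) by (subst nn_integral_count_space_nn_integral) auto
  also have "\<dots> \<le> (\<integral>\<^sup>+i. K * emeasure \<mu> (Q i) \<partial>count_space C)"
    using dbl C(2) by (intro nn_integral_mono) (auto simp: Q_def s_def J'_def)
  finally have "t * emeasure \<mu> {x. t < wmax \<mu> J g x} \<le> t * (\<integral>\<^sup>+i. K * emeasure \<mu> (Q i) \<partial>count_space C)"
    by (intro mult_left_mono) auto
  also have "\<dots> = (\<integral>\<^sup>+i. K * (t * emeasure \<mu> (Q i)) \<partial>count_space C)"
    by (subst nn_integral_cmult[symmetric]) (auto simp: mult_ac)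
  also have "\<dots> \<le> (\<integral>\<^sup>+i. K * (\<integral>\<^sup>+y\<in>Q i. g y \<partial>\<mu>) \<partial>count_space C)"
  proof (intro nn_integral_mono mult_left_mono)
    fix i assume "i \<in> space (count_space C)"
    then have *: "t < (\<integral>\<^sup>+y\<in>Q i. g y \<partial>\<mu>) / emeasure \<mu> (Q i)"
      using C(2) by (auto simp: J'_def Q_def)
    show "t * emeasure \<mu> (Q i) \<le> (\<integral>\<^sup>+y\<in>Q i. g y \<partial>\<mu>)"
    proof (cases "emeasure \<mu> (Q i) = 0 \<or> emeasure \<mu> (Q i) = top")
      \<comment> \<open>Measure 0 makes the left side 0; measure \<open>top\<close> makes the
        quotient 0, which contradicts the strict inequality \<open>*\<close>.\<close>
      case True
      then show ?thesis using * by auto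
    next
      case False
      have "t * emeasure \<mu> (Q i) \<le> (\<integral>\<^sup>+y\<in>Q i. g y \<partial>\<mu>) / emeasure \<mu> (Q i) * emeasure \<mu> (Q i)"
        using * by (intro mult_right_mono) auto
      also have "\<dots> = (\<integral>\<^sup>+y\<in>Q i. g y \<partial>\<mu>)"
        using False by (simp add: ennreal_divide_times ennreal_divide_self less_top)
      finally show ?thesis .
    qed
  qed auto
  also have "\<dots> = K * (\<integral>\<^sup>+x. (\<integral>\<^sup>+i. g x * indicator (Q i) x \<partial>count_space C) \<partial>\<mu>)"
    using C(1) g by (subst nn_integral_count_space_nn_integral) (auto simp: nn_integral_cmult)
  also have "\<dots> \<le> K * (\<integral>\<^sup>+x. g x \<partial>\<mu>)"
  proof (intro mult_left_mono nn_integral_mono)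
    fix x
    show "(\<integral>\<^sup>+i. g x * indicator (Q i) x \<partial>count_space C) \<le> g x"
    proof (cases "\<exists>i\<in>C. x \<in> Q i")
      case True
      then obtain i where i: "i \<in> C" "x \<in> Q i" by blast
      have "(\<integral>\<^sup>+k. g x * indicator (Q k) x \<partial>count_space C) = (\<integral>\<^sup>+k. g x * indicator {i} k \<partial>count_space C)"
      proof (intro nn_integral_cong)
        fix k assume "k \<in> space (count_space C)"
        then have "k = i \<or> x \<notin> Q k"
          using disj[OF i(1), of k] i(2) by (auto simp: disjnt_iff)
        then show "g x * indicator (Q k) x = g x * indicator {i} k"
          using i(2) by (auto simp: indicator_def)
      qed
      also have "\<dots> = g x"
        using i by (subst nn_integral_cmult_indicator) auto
      finally show ?thesis by simp
    next
      case False
      then have "(\<integral>\<^sup>+k. g x * indicator (Q k) x \<partial>count_space C) = (\<integral>\<^sup>+k. 0 \<partial>count_space C)"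
        by (intro nn_integral_cong) (auto simp: indicator_def)
      then show ?thesis by simp
    qed
  qed auto
  finally show ?thesis .
qed

text \<open>The average of a constant is at most that constant. This is the
  \<open>L\<^sup>\<infinity>\<close> half of the interpolation, used with \<open>h\<close> the part
  of \<open>g\<close> above a threshold and \<open>c\<close> a bound for the rest.\<close>

lemma wmax_le_add_const:
  assumes \<mu>: "sets \<mu> = sets lebesgue"
    and h: "h \<in> borel_measurable \<mu>" and le: "\<And>x. g x \<le> h x + c"
  shows "wmax \<mu> J g x \<le> wmax \<mu> J h x + c"
proof -
  have [measurable]: "qcube a l \<in> sets \<mu>" for a l
    using \<mu> by simp
  have "indicator (qcube a l) x * ((\<integral>\<^sup>+y\<in>qcube a l. g y \<partial>\<mu>) / emeasure \<mu> (qcube a l))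
     \<le> wmax \<mu> J h x + c" if "(a, l) \<in> J" for a l
  proof -
    let ?Q = "qcube a l"
    have "(\<integral>\<^sup>+y\<in>?Q. g y \<partial>\<mu>) \<le> (\<integral>\<^sup>+y. h y * indicator ?Q y + c * indicator ?Q y \<partial>\<mu>)"
      using le by (intro nn_integral_mono) (auto simp: indicator_def)
    also have "\<dots> = (\<integral>\<^sup>+y\<in>?Q. h y \<partial>\<mu>) + c * emeasure \<mu> ?Q"
      using h by (subst nn_integral_add) (auto simp: nn_integral_cmult_indicator)
    finally have "(\<integral>\<^sup>+y\<in>?Q. g y \<partial>\<mu>) / emeasure \<mu> ?Q
        \<le> (\<integral>\<^sup>+y\<in>?Q. h y \<partial>\<mu>) / emeasure \<mu> ?Q + c * emeasure \<mu> ?Q / emeasure \<mu> ?Q"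
      unfolding add_divide_distrib_ennreal[symmetric] by (rule divide_right_mono_ennreal)
    also have "c * emeasure \<mu> ?Q / emeasure \<mu> ?Q \<le> c"
      by (cases "emeasure \<mu> ?Q = 0 \<or> emeasure \<mu> ?Q = top")
        (auto simp: ennreal_divide_self less_top simp flip: ennreal_times_divide)
    finally have "indicator ?Q x * ((\<integral>\<^sup>+y\<in>?Q. g y \<partial>\<mu>) / emeasure \<mu> ?Q)
        \<le> indicator ?Q x * ((\<integral>\<^sup>+y\<in>?Q. h y \<partial>\<mu>) / emeasure \<mu> ?Q) + c"
      by (cases "x \<in> ?Q") (auto intro: order_trans add_left_mono)
    also have "\<dots> \<le> wmax \<mu> J h x + c"
      unfolding wmax_def using that by (intro add_right_mono SUP_upper2[of "(a, l)"]) auto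
    finally show ?thesis .
  qed
  then show ?thesis
    unfolding wmax_def[of \<mu> J g] by (intro SUP_least) auto
qed

text \<open>Marcinkiewicz interpolation between the weak \<open>(1,1)\<close> bound and the trivial \<open>L\<^sup>\<infinity>\<close> bound.\<close>
lemma wmax_strong_type:
  fixes \<mu> :: "'a::euclidean_space measure"
  assumes J: "countable J" and \<mu>: "sets \<mu> = sets lebesgue" and sf: "sigma_finite_measure \<mu>"
    and dbl: "\<And>a l. (a, l) \<in> J \<Longrightarrow> 0 < l \<and> l \<le> B \<and>
        emeasure \<mu> (cball a (5 * (sqrt (real DIM('a)) * l))) \<le> K * emeasure \<mu> (qcube a l)"
    and g: "g \<in> borel_measurable \<mu>" and q: "1 < q"
  shows "(\<integral>\<^sup>+x. enn_powr (wmax \<mu> J g x) q \<partial>\<mu>)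
    \<le> K * ennreal (2 powr q * q / (q - 1)) * (\<integral>\<^sup>+x. enn_powr (g x) q \<partial>\<mu>)"
proof -
  interpret sigma_finite_measure \<mu> by (fact sf)
  interpret P: pair_sigma_finite \<mu> "lborel :: real measure" ..
  have [measurable]: "g \<in> borel_measurable \<mu>" "wmax \<mu> J g \<in> borel_measurable \<mu>"
    using g borel_measurable_wmax[OF J \<mu>] by auto
  have weak: "emeasure \<mu> {x\<in>space \<mu>. ennreal t < wmax \<mu> J g x}
      \<le> ennreal (2 / t) * (K * (\<integral>\<^sup>+y. (if ennreal t < 2 * g y then g y else 0) \<partial>\<mu>))" if t: "0 < t" for t
  proof -
    \<comment> \<open>\<open>h\<close> keeps the values of \<open>g\<close> above
      \<open>t / 2\<close>. The remainder is at most \<open>t / 2\<close>, so the maximal function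
      of \<open>g\<close> can exceed \<open>t\<close> only where that of \<open>h\<close> exceeds
      \<open>t / 2\<close>.\<close>
    define h where "h y = (if ennreal t < 2 * g y then g y else 0)" for y
    have [measurable]: "h \<in> borel_measurable \<mu>"
      unfolding h_def[abs_def] by measurable
    have le: "g y \<le> h y + ennreal (t / 2)" for y
    proof (cases "ennreal t < 2 * g y")
      case False
      then have "2 * g y \<le> ennreal t" by simp
      then have "g y \<le> ennreal (t / 2)"
        using t by (cases "g y") (auto simp: ennreal_mult_top top_unique simp flip: ennreal_numeral ennreal_mult)
      then show ?thesis by (simp add: h_def False)
    qed (simp add: h_def)
    have "{x\<in>space \<mu>. ennreal t < wmax \<mu> J g x} \<subseteq> {x\<in>space \<mu>. ennreal (t / 2) < wmax \<mu> J h x}"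
    proof safe
      fix x assume *: "ennreal t < wmax \<mu> J g x"
      have "ennreal (t / 2) + ennreal (t / 2) = ennreal t"
        using t by (simp flip: ennreal_plus)
      moreover have "wmax \<mu> J g x \<le> wmax \<mu> J h x + ennreal (t / 2)"
        by (rule wmax_le_add_const[OF \<mu> _ le]) measurable
      ultimately have "ennreal (t / 2) + ennreal (t / 2) < wmax \<mu> J h x + ennreal (t / 2)"
        using * by simp
      then show "ennreal (t / 2) < wmax \<mu> J h x"
        by (meson add_right_mono leD leI)
    qed
    moreover have sp: "space \<mu> = UNIV"
      using sets_eq_imp_space_eq[OF \<mu>] by simp
    moreover have "{x\<in>space \<mu>. ennreal (t / 2) < wmax \<mu> J h x} \<in> sets \<mu>"
      using borel_measurable_wmax[OF J \<mu>, of h] by measurable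
    ultimately have "emeasure \<mu> {x\<in>space \<mu>. ennreal t < wmax \<mu> J g x} \<le> emeasure \<mu> {x. ennreal (t / 2) < wmax \<mu> J h x}"
      by (intro emeasure_mono) auto
    also have "\<dots> = ennreal (2 / t) * (ennreal (t / 2) * emeasure \<mu> {x. ennreal (t / 2) < wmax \<mu> J h x})"
      using t by (simp add: mult.assoc[symmetric] flip: ennreal_mult)
    also have "\<dots> \<le> ennreal (2 / t) * (K * (\<integral>\<^sup>+y. h y \<partial>\<mu>))"
      by (intro mult_left_mono wmax_weak_type[OF J \<mu> dbl]) auto
    finally show ?thesis by (simp add: h_def)
  qed
  have "(\<integral>\<^sup>+x. enn_powr (wmax \<mu> J g x) q \<partial>\<mu>)
      = (\<integral>\<^sup>+x. (\<integral>\<^sup>+t. (if 0 < t \<and> ennreal t < wmax \<mu> J g x then ennreal (q * t powr (q - 1)) else 0) \<partial>lborel) \<partial>\<mu>)"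
    using q by (subst layer_cake) (auto intro!: nn_integral_cong simp: indicator_def)
  also have "\<dots> = (\<integral>\<^sup>+t. (\<integral>\<^sup>+x. (if 0 < t \<and> ennreal t < wmax \<mu> J g x then ennreal (q * t powr (q - 1)) else 0) \<partial>\<mu>) \<partial>lborel)"
    by (rule P.Fubini'[symmetric]) measurable
  \<comment> \<open>The density \<open>q * t powr (q - 1)\<close> times the factor
    \<open>2 / t\<close> of the weak bound is rewritten as a multiple of the layer-cake density for
    the exponent \<open>q - 1\<close>. After the second use of Fubini the integral in
    \<open>t\<close> is then \<open>enn_powr (2 * g x) (q - 1)\<close>.\<close>
  also have "\<dots> \<le> (\<integral>\<^sup>+t. (\<integral>\<^sup>+x. K * (g x * (ennreal (2 * q / (q - 1)) *
      (if 0 < t \<and> ennreal t < 2 * g x then ennreal ((q - 1) * t powr (q - 1 - 1)) else 0))) \<partial>\<mu>) \<partial>lborel)"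
  proof (rule nn_integral_mono)
    fix t :: real
    show "(\<integral>\<^sup>+x. (if 0 < t \<and> ennreal t < wmax \<mu> J g x then ennreal (q * t powr (q - 1)) else 0) \<partial>\<mu>)
      \<le> (\<integral>\<^sup>+x. K * (g x * (ennreal (2 * q / (q - 1)) *
      (if 0 < t \<and> ennreal t < 2 * g x then ennreal ((q - 1) * t powr (q - 1 - 1)) else 0))) \<partial>\<mu>)"
    proof (cases "0 < t")
      case t: True
      have "(\<integral>\<^sup>+x. (if 0 < t \<and> ennreal t < wmax \<mu> J g x then ennreal (q * t powr (q - 1)) else 0) \<partial>\<mu>)
        = (\<integral>\<^sup>+x. ennreal (q * t powr (q - 1)) * indicator {x\<in>space \<mu>. ennreal t < wmax \<mu> J g x} x \<partial>\<mu>)"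
        using t by (intro nn_integral_cong) (auto simp: indicator_def)
      also have "\<dots> = ennreal (q * t powr (q - 1)) * emeasure \<mu> {x\<in>space \<mu>. ennreal t < wmax \<mu> J g x}"
        by (subst nn_integral_cmult_indicator) auto
      also have "\<dots> \<le> ennreal (q * t powr (q - 1)) * (ennreal (2 / t) *
           (K * (\<integral>\<^sup>+y. (if ennreal t < 2 * g y then g y else 0) \<partial>\<mu>)))"
        using weak[OF t] by (intro mult_left_mono) auto
      also have "\<dots> = (K * ennreal (2 * q / (q - 1)) * ennreal ((q - 1) * t powr (q - 1 - 1))) *
           (\<integral>\<^sup>+y. (if ennreal t < 2 * g y then g y else 0) \<partial>\<mu>)"
      proof -
        have "(q * t powr (q - 1)) * (2 / t) = (2 * q / (q - 1)) * ((q - 1) * t powr (q - 1 - 1))"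
          using t q by (simp add: powr_diff field_simps power2_eq_square)
        then have e: "ennreal (q * t powr (q - 1)) * ennreal (2 / t) = ennreal (2 * q / (q - 1)) * ennreal ((q - 1) * t powr (q - 1 - 1))"
          using t q by (simp flip: ennreal_mult)
        then show ?thesis
          by (subst mult.assoc[symmetric], subst e) (simp only: mult_ac)
      qed
      also have "\<dots> = (\<integral>\<^sup>+x. (K * ennreal (2 * q / (q - 1)) * ennreal ((q - 1) * t powr (q - 1 - 1))) *
            (if ennreal t < 2 * g x then g x else 0) \<partial>\<mu>)"
        by (subst nn_integral_cmult) auto
      also have "\<dots> = (\<integral>\<^sup>+x. K * (g x * (ennreal (2 * q / (q - 1)) *
         (if 0 < t \<and> ennreal t < 2 * g x then ennreal ((q - 1) * t powr (q - 1 - 1)) else 0))) \<partial>\<mu>)"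
        using t by (intro nn_integral_cong) (auto simp: mult_ac)
      finally show ?thesis .
    qed simp
  qed
  also have "\<dots> = (\<integral>\<^sup>+x. (\<integral>\<^sup>+t. K * (g x * (ennreal (2 * q / (q - 1)) *
      (if 0 < t \<and> ennreal t < 2 * g x then ennreal ((q - 1) * t powr (q - 1 - 1)) else 0))) \<partial>lborel) \<partial>\<mu>)"
    by (rule P.Fubini') measurable
  also have "\<dots> = (\<integral>\<^sup>+x. K * (g x * (ennreal (2 * q / (q - 1)) * enn_powr (2 * g x) (q - 1))) \<partial>\<mu>)"
    using q by (subst layer_cake)
      (auto simp: nn_integral_cmult indicator_def intro!: nn_integral_cong arg_cong[where f = "\<lambda>x. _ * x"])
  also have "\<dots> = (\<integral>\<^sup>+x. (K * ennreal (2 powr q * q / (q - 1))) * enn_powr (g x) q \<partial>\<mu>)"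
  proof (intro nn_integral_cong)
    fix x
    have "enn_powr 2 (q - 1) = ennreal (2 powr (q - 1))"
      using enn_powr_ennreal[of 2 "q - 1"] by simp
    then have c: "ennreal (2 * q / (q - 1)) * enn_powr 2 (q - 1) = ennreal (2 powr q * q / (q - 1))"
      using q by (simp add: powr_diff field_simps flip: ennreal_mult)
    have g: "enn_powr (g x) q = g x * enn_powr (g x) (q - 1)"
      using enn_powr_add[of 1 "q - 1" "g x"] q by simp
    have "K * (g x * (ennreal (2 * q / (q - 1)) * enn_powr (2 * g x) (q - 1)))
       = K * (ennreal (2 * q / (q - 1)) * enn_powr 2 (q - 1)) * (g x * enn_powr (g x) (q - 1))"
      using q by (simp add: enn_powr_mult mult_ac)
    then show "K * (g x * (ennreal (2 * q / (q - 1)) * enn_powr (2 * g x) (q - 1)))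
       = (K * ennreal (2 powr q * q / (q - 1))) * enn_powr (g x) q"
      by (simp only: c g)
  qed
  also have "\<dots> = K * ennreal (2 powr q * q / (q - 1)) * (\<integral>\<^sup>+x. enn_powr (g x) q \<partial>\<mu>)"
    by (subst nn_integral_cmult) auto
  finally show ?thesis .
qed

subsection \<open>Muckenhoupt's theorem\<close>

lemma emeasure_qcube:
  fixes a :: "'a::euclidean_space"
  assumes "0 \<le> l"
  shows "emeasure lebesgue (qcube a l) = ennreal ((2 * l) ^ DIM('a))"
proof -
  have "(a + l *\<^sub>R One - (a - l *\<^sub>R One)) \<bullet> i = 2 * l" if "i \<in> Basis" for i
    using that by (simp add: inner_diff_left inner_add_left)
  then have "(\<Prod>i\<in>Basis. (a + l *\<^sub>R One - (a - l *\<^sub>R One)) \<bullet> i) = (2 * l) ^ DIM('a)"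
    by simp
  moreover have "\<forall>i\<in>Basis. (a - l *\<^sub>R One) \<bullet> i \<le> (a + l *\<^sub>R One) \<bullet> i"
    using assms by (simp add: inner_diff_left inner_add_left)
  ultimately show ?thesis
    by (simp add: qcube_def emeasure_lborel_cbox_eq)
qed

lemma measure_qcube:
  fixes a :: "'a::euclidean_space"
  shows "0 \<le> l \<Longrightarrow> measure lebesgue (qcube a l) = (2 * l) ^ DIM('a)"
  using emeasure_qcube[of l a] by (simp add: measure_def)

lemma sigma_finite_lebesgue: "sigma_finite_measure (lebesgue :: 'a::euclidean_space measure)"
proof
  obtain A :: "'a set set" where A: "countable A" "A \<subseteq> sets lborel" "\<Union>A = space lborel"
      "\<forall>a\<in>A. emeasure lborel a \<noteq> \<infinity>"
    using lborel.sigma_finite_countable by blast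
  have "emeasure lebesgue a \<noteq> \<infinity>" if "a \<in> A" for a
    using A(2,4) that by (subst emeasure_completion) (auto simp: subset_iff)
  moreover have "A \<subseteq> sets lebesgue"
    using A(2) by auto
  ultimately show "\<exists>A :: 'a set set. countable A \<and> A \<subseteq> sets lebesgue \<and> \<Union>A = space lebesgue \<and>
      (\<forall>a\<in>A. emeasure lebesgue a \<noteq> \<infinity>)"
    using A(1,3) by auto
qed

section \<open>Consequences of the A_p condition on a single cube\<close>

locale weight =
  fixes w :: "'a::euclidean_space \<Rightarrow> real" and p :: real
  assumes w_nonneg: "0 \<le> w x"
    and w_measurable [measurable]: "w \<in> borel_measurable lebesgue"
    and p_gt_1: "1 < p"
begin

text \<open>Where \<open>w x = 0\<close> this is 0, not infinite, because
  \<open>0 powr _ = 0\<close>. Hence the lower bounds for \<open>S\<close> below ask for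
  \<open>w\<close> to be positive almost everywhere on the set, which A_p provides on cubes of
  positive \<open>W\<close> measure.\<close>

definition dual :: "'a \<Rightarrow> real" where
  "dual x = w x powr (- 1 / (p - 1))"

abbreviation W :: "'a measure" where
  "W \<equiv> density lebesgue (\<lambda>x. ennreal (w x))"

abbreviation S :: "'a measure" where
  "S \<equiv> density lebesgue (\<lambda>x. ennreal (dual x))"

text \<open>The \<open>A\<^sub>p\<close> condition on \<open>Q\<close> in the form in which testing the norm inequality yields it.\<close>
definition Ap_on :: "real \<Rightarrow> 'a set \<Rightarrow> bool" where
  "Ap_on c Q \<longleftrightarrow> (\<forall>f\<in>borel_measurable lebesgue.
     enn_powr (avg Q (\<lambda>x. ennreal \<bar>f x\<bar>)) p * emeasure W Q
       \<le> ennreal c * (\<integral>\<^sup>+x\<in>Q. enn_powr (ennreal \<bar>f x\<bar>) p \<partial>W))"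

lemma dual_measurable [measurable]: "dual \<in> borel_measurable lebesgue"
  unfolding dual_def[abs_def] by measurable

lemma emeasure_W: "Q \<in> sets lebesgue \<Longrightarrow> emeasure W Q = (\<integral>\<^sup>+x\<in>Q. ennreal (w x) \<partial>lebesgue)"
  by (subst emeasure_density) auto

lemma emeasure_S: "Q \<in> sets lebesgue \<Longrightarrow> emeasure S Q = (\<integral>\<^sup>+x\<in>Q. ennreal (dual x) \<partial>lebesgue)"
  by (subst emeasure_density) auto

lemma sigma_finite_W: "sigma_finite_measure W"
  by (subst sigma_finite_measure.sigma_finite_iff_density_finite[OF sigma_finite_lebesgue]) auto

lemma sigma_finite_S: "sigma_finite_measure S"
  by (subst sigma_finite_measure.sigma_finite_iff_density_finite[OF sigma_finite_lebesgue]) auto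

lemma Ap_on_indicator:
  assumes "Ap_on c Q" and Q [measurable]: "Q \<in> sets lebesgue" and E [measurable]: "E \<in> sets lebesgue"
  shows "enn_powr (ennreal (1 / measure lebesgue Q) * emeasure lebesgue (Q \<inter> E)) p * emeasure W Q
    \<le> ennreal c * emeasure W (Q \<inter> E)"
proof -
  have "enn_powr (avg Q (\<lambda>x. ennreal \<bar>indicator E x\<bar>)) p * emeasure W Q
       \<le> ennreal c * (\<integral>\<^sup>+x\<in>Q. enn_powr (ennreal \<bar>indicator E x\<bar>) p \<partial>W)"
    using assms(1) unfolding Ap_on_def by (rule bspec) measurable
  moreover have "(\<integral>\<^sup>+x\<in>Q. enn_powr (ennreal \<bar>indicator E x\<bar>) p \<partial>W) = (\<integral>\<^sup>+x. indicator (Q \<inter> E) x \<partial>W)"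
    by (intro nn_integral_cong) (auto simp: indicator_def)
  moreover have "(\<integral>\<^sup>+x\<in>Q. ennreal \<bar>indicator E x\<bar> \<partial>lebesgue) = (\<integral>\<^sup>+x. indicator (Q \<inter> E) x \<partial>lebesgue)"
    by (intro nn_integral_cong) (auto simp: indicator_def)
  ultimately show ?thesis
    by (simp add: avg_def)
qed

text \<open>Test A_p with the indicator of the zero set of \<open>w\<close>: the right side
  vanishes, hence so does the Lebesgue measure of that set inside \<open>Q\<close>.\<close>

lemma Ap_on_pos_AE:
  assumes ap: "Ap_on c Q" and Q [measurable]: "Q \<in> sets lebesgue"
    and m: "0 < measure lebesgue Q" and pos: "0 < emeasure W Q"
  shows "AE x in lebesgue. x \<in> Q \<longrightarrow> 0 < w x"
proof -
  define Z where "Z = {x. w x = 0}"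
  have [measurable]: "Z \<in> sets lebesgue"
    unfolding Z_def using measurable_sets[OF w_measurable, of "{0}"] by (simp add: vimage_def)
  have "emeasure W (Q \<inter> Z) = (\<integral>\<^sup>+x. 0 \<partial>(lebesgue :: 'a measure))"
    unfolding emeasure_W[OF sets.Int[OF Q \<open>Z \<in> sets lebesgue\<close>]]
    by (rule nn_integral_cong) (auto simp: Z_def split: split_indicator)
  then have "enn_powr (ennreal (1 / measure lebesgue Q) * emeasure lebesgue (Q \<inter> Z)) p * emeasure W Q = 0"
    using Ap_on_indicator[OF ap Q \<open>Z \<in> sets lebesgue\<close>] by simp
  then have "emeasure lebesgue (Q \<inter> Z) = 0"
    using pos m by (auto simp: zero_less_iff_neq_zero)
  then have "AE x in lebesgue. x \<notin> Q \<inter> Z"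
    by (intro AE_not_in) (auto simp: null_sets_def)
  then show ?thesis
    by eventually_elim (use w_nonneg in \<open>auto simp: Z_def less_le\<close>)
qed

text \<open>This is the classical two-weight product form of A_p. It comes from testing with
  \<open>dual\<close> itself, for which \<open>dual powr p * w = dual\<close>, and dividing by the
  integral of \<open>dual\<close>. That integral is not yet known to be finite, so the test
  functions are truncations and the bound passes to their supremum.\<close>

lemma Ap_on_dual:
  assumes ap: "Ap_on c Q" and Q [measurable]: "Q \<in> sets lebesgue"
    and m: "0 < measure lebesgue Q" and c: "0 \<le> c"
  shows "emeasure W Q * enn_powr (emeasure S Q) (p - 1) \<le> ennreal c * ennreal (measure lebesgue Q powr p)"
proof -
  define \<mu> where "\<mu> = measure lebesgue Q"
  have em: "emeasure lebesgue Q = ennreal \<mu>"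
    using m unfolding \<mu>_def by (metis emeasure_eq_ennreal_measure less_irrefl measure_zero_top)
  have mu: "0 < \<mu>" using m by (simp add: \<mu>_def)
  \<comment> \<open>Values above \<open>N\<close> are replaced by 0 and not by \<open>N\<close>,
    which preserves the identity \<open>f N x powr p * w x = f N x\<close>.\<close>
  define f where "f N x = (if dual x \<le> real N then dual x else 0)" for N :: nat and x
  have dual_nn: "0 \<le> dual x" for x by (simp add: dual_def)
  have [measurable]: "f N \<in> borel_measurable lebesgue" for N
    unfolding f_def[abs_def] by measurable
  have f_nn: "0 \<le> f N x" for N x by (simp add: f_def dual_nn)
  define I where "I N = (\<integral>\<^sup>+x\<in>Q. ennreal (f N x) \<partial>lebesgue)" for N
  have fw: "f N x powr p * w x = f N x" for N x
  proof (cases "w x = 0")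
    case False
    then have "0 < w x" using w_nonneg[of x] by simp
    then have "dual x powr p * w x = w x powr (- 1 / (p - 1) * p + 1)"
      using powr_add[of "w x" "- 1 / (p - 1) * p" 1] by (simp add: dual_def powr_powr)
    also have "- 1 / (p - 1) * p + 1 = - 1 / (p - 1)"
      using p_gt_1 by (simp add: field_simps)
    finally have "dual x powr p * w x = dual x" by (simp add: dual_def)
    then show ?thesis by (simp add: f_def)
  qed (simp add: f_def dual_def)
  have bound: "emeasure W Q * enn_powr (I N) (p - 1) \<le> ennreal c * ennreal (\<mu> powr p)" for N
  proof (cases "I N = 0")
    case False
    have "I N \<le> (\<integral>\<^sup>+x\<in>Q. ennreal (real N) \<partial>lebesgue)"
      unfolding I_def by (intro nn_integral_mono) (auto simp: f_def indicator_def)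
    also have "\<dots> = ennreal (real N) * ennreal \<mu>"
      by (simp add: nn_integral_cmult_indicator em)
    also have "\<dots> < top" by (simp add: ennreal_mult_less_top)
    finally have fin: "I N \<noteq> top" by simp
    have "enn_powr (avg Q (\<lambda>x. ennreal \<bar>f N x\<bar>)) p * emeasure W Q
       \<le> ennreal c * (\<integral>\<^sup>+x\<in>Q. enn_powr (ennreal \<bar>f N x\<bar>) p \<partial>W)"
      using ap unfolding Ap_on_def by (rule bspec) measurable
    also have "(\<integral>\<^sup>+x\<in>Q. enn_powr (ennreal \<bar>f N x\<bar>) p \<partial>W) = (\<integral>\<^sup>+x. ennreal (w x) * (enn_powr (ennreal \<bar>f N x\<bar>) p * indicator Q x) \<partial>lebesgue)"
      by (subst nn_integral_density) auto
    also have "\<dots> = I N"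
      unfolding I_def
    proof (intro nn_integral_cong)
      fix x
      have "ennreal (w x) * enn_powr (ennreal (f N x)) p = ennreal (f N x powr p * w x)"
        using f_nn w_nonneg[of x] by (simp add: enn_powr_ennreal ennreal_mult mult.commute)
      then show "ennreal (w x) * (enn_powr (ennreal \<bar>f N x\<bar>) p * indicator Q x) = ennreal (f N x) * indicator Q x"
        using f_nn fw[of N x] by (simp flip: mult.assoc)
    qed
    also have "avg Q (\<lambda>x. ennreal \<bar>f N x\<bar>) = ennreal (1 / \<mu>) * I N"
      using f_nn by (simp add: avg_def I_def \<mu>_def)
    finally have "enn_powr (ennreal (1 / \<mu>) * I N) p * emeasure W Q \<le> ennreal c * I N" .
    moreover have "enn_powr (ennreal (1 / \<mu>) * I N) p = ennreal ((1 / \<mu>) powr p) * (I N * enn_powr (I N) (p - 1))"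
      using p_gt_1 mu enn_powr_add[of 1 "p - 1" "I N"] by (simp add: enn_powr_mult enn_powr_ennreal)
    ultimately have "ennreal (\<mu> powr p) * (ennreal ((1 / \<mu>) powr p) * (I N * enn_powr (I N) (p - 1)) * emeasure W Q) \<le> ennreal (\<mu> powr p) * (ennreal c * I N)"
      by (intro mult_left_mono) auto
    moreover have "ennreal (\<mu> powr p) * ennreal ((1 / \<mu>) powr p) = 1"
      using mu by (simp add: powr_divide flip: ennreal_mult)
    moreover have "ennreal (\<mu> powr p) * (ennreal ((1 / \<mu>) powr p) * (I N * enn_powr (I N) (p - 1)) * emeasure W Q)
       = (ennreal (\<mu> powr p) * ennreal ((1 / \<mu>) powr p)) * (I N * (emeasure W Q * enn_powr (I N) (p - 1)))"
      by (simp only: mult_ac)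
    moreover have "ennreal (\<mu> powr p) * (ennreal c * I N) = I N * (ennreal c * ennreal (\<mu> powr p))"
      by (simp only: mult_ac)
    ultimately have "I N * (emeasure W Q * enn_powr (I N) (p - 1)) \<le> I N * (ennreal c * ennreal (\<mu> powr p))"
      by simp
    then show ?thesis
      using False fin by (simp add: ennreal_mult_le_mult_iff)
  qed simp
  have "emeasure S Q = (SUP N. I N)"
  proof -
    have inc: "incseq (\<lambda>N x. ennreal (f N x) * indicator Q x)"
      by (auto simp: incseq_def le_fun_def f_def indicator_def dual_nn)
    have "(SUP N. ennreal (f N x) * indicator Q x) = ennreal (dual x) * indicator Q x" for x
    proof (rule antisym)
      show "(SUP N. ennreal (f N x) * indicator Q x) \<le> ennreal (dual x) * indicator Q x"
        by (intro SUP_least) (auto simp: f_def indicator_def)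
      obtain N where "dual x \<le> real N" using real_arch_simple by blast
      then show "ennreal (dual x) * indicator Q x \<le> (SUP N. ennreal (f N x) * indicator Q x)"
        by (intro SUP_upper2[of N]) (auto simp: f_def)
    qed
    then have "emeasure S Q = (\<integral>\<^sup>+x. (SUP N. ennreal (f N x) * indicator Q x) \<partial>lebesgue)"
      by (simp add: emeasure_S)
    also have "\<dots> = (SUP N. I N)"
      unfolding I_def by (rule nn_integral_monotone_convergence_SUP[OF inc]) measurable
    finally show ?thesis .
  qed
  then show ?thesis
    using bound p_gt_1 by (simp add: enn_powr_SUP SUP_mult_left_ennreal SUP_least \<mu>_def)
qed

text \<open>A substitute for Hoelder's inequality: integrate
  \<open>1 \<le> w / \<alpha> + \<alpha> powr (1 / (p - 1)) * dual\<close> with \<open>\<alpha>\<close> twice the mean of \<open>w\<close>.\<close>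
lemma measure_powr_le:
  assumes E [measurable]: "E \<in> sets lebesgue" and m: "0 < measure lebesgue E"
    and pos: "AE x in lebesgue. x \<in> E \<longrightarrow> 0 < w x"
    and W: "emeasure W E \<noteq> 0" "emeasure W E \<noteq> top"
  shows "ennreal (measure lebesgue E powr p) \<le> ennreal (2 powr p) * (emeasure W E * enn_powr (emeasure S E) (p - 1))"
proof (cases "emeasure S E")
  case (real s)
  define \<mu> where "\<mu> = measure lebesgue E"
  have em: "emeasure lebesgue E = ennreal \<mu>"
    using m unfolding \<mu>_def by (metis emeasure_eq_ennreal_measure less_irrefl measure_zero_top)
  have mu: "0 < \<mu>" using m by (simp add: \<mu>_def)
  obtain v where v: "emeasure W E = ennreal v" "0 < v"
    using W by (cases "emeasure W E") auto
  define \<alpha> where "\<alpha> = 2 * v / \<mu>"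
  have \<alpha>: "0 < \<alpha>" using v mu by (simp add: \<alpha>_def)
  define \<beta> where "\<beta> = \<alpha> powr (1 / (p - 1))"
  have \<beta>: "0 < \<beta>" using \<alpha> by (simp add: \<beta>_def)
  have key: "1 \<le> w x / \<alpha> + \<beta> * dual x" if "0 < w x" for x
  proof (cases "\<alpha> \<le> w x")
    case True
    then have "1 \<le> w x / \<alpha>" using \<alpha> by simp
    moreover have "0 \<le> \<beta> * dual x" using \<beta> by (simp add: dual_def)
    ultimately show ?thesis by linarith
  next
    case False
    then have "w x powr (1 / (p - 1)) \<le> \<beta>"
      unfolding \<beta>_def using that p_gt_1 by (intro powr_mono2) auto
    then have "w x powr (1 / (p - 1)) * dual x \<le> \<beta> * dual x"
      by (intro mult_right_mono) (auto simp: dual_def)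
    moreover have "w x powr (1 / (p - 1)) * dual x = 1"
      using that by (simp add: dual_def flip: powr_add)
    ultimately show ?thesis using that \<alpha> by (simp add: add_increasing)
  qed
  have "ennreal \<mu> = (\<integral>\<^sup>+x. indicator E x \<partial>lebesgue)"
    by (simp add: em)
  also have "\<dots> \<le> (\<integral>\<^sup>+x. ennreal (1 / \<alpha>) * (ennreal (w x) * indicator E x) + ennreal \<beta> * (ennreal (dual x) * indicator E x) \<partial>lebesgue)"
  proof (intro nn_integral_mono_AE)
    show "AE x in lebesgue. indicator E x \<le> ennreal (1 / \<alpha>) * (ennreal (w x) * indicator E x) + ennreal \<beta> * (ennreal (dual x) * indicator E x)"
      using pos
    proof eventually_elim
      case (elim x)
      show ?case
      proof (cases "x \<in> E")
        case True
        then have "ennreal 1 \<le> ennreal (1 / \<alpha> * w x + \<beta> * dual x)"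
          using key[of x] elim by (intro ennreal_leI) auto
        also have "\<dots> = ennreal (1 / \<alpha>) * ennreal (w x) + ennreal \<beta> * ennreal (dual x)"
          using \<alpha> \<beta> w_nonneg[of x] by (subst ennreal_plus) (auto simp: dual_def simp flip: ennreal_mult)
        finally show ?thesis using True by simp
      qed simp
    qed
  qed
  also have "\<dots> = ennreal (1 / \<alpha>) * emeasure W E + ennreal \<beta> * emeasure S E"
    by (simp add: nn_integral_add nn_integral_cmult emeasure_W emeasure_S)
  also have "\<dots> = ennreal (1 / \<alpha> * v + \<beta> * s)"
    using \<alpha> \<beta> v real by (simp add: ennreal_plus flip: ennreal_mult)
  finally have "\<mu> \<le> 1 / \<alpha> * v + \<beta> * s"
    using \<alpha> \<beta> v real by (subst (asm) ennreal_le_iff) auto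
  \<comment> \<open>By the choice of \<open>\<alpha>\<close> the \<open>w\<close> term accounts for
    exactly half of \<open>\<mu>\<close>, so the \<open>dual\<close> term carries the other half;
    this is the source of the factor \<open>2 powr p\<close>.\<close>
  moreover have "1 / \<alpha> * v = \<mu> / 2"
    using v mu by (simp add: \<alpha>_def)
  ultimately have "\<mu> / 2 \<le> \<beta> * s" by simp
  then have "(\<mu> / 2) powr (p - 1) \<le> (\<beta> * s) powr (p - 1)"
    using mu p_gt_1 by (intro powr_mono2) auto
  also have "\<dots> = \<alpha> * s powr (p - 1)"
    using \<beta> real p_gt_1 \<alpha> by (simp add: powr_mult \<beta>_def powr_powr)
  finally have "\<mu> * (\<mu> / 2) powr (p - 1) \<le> \<mu> * (\<alpha> * s powr (p - 1))"
    using mu by (intro mult_left_mono) auto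
  also have "\<dots> = 2 * (v * s powr (p - 1))"
    using mu by (simp add: \<alpha>_def)
  finally have "2 powr (p - 1) * (\<mu> * (\<mu> / 2) powr (p - 1)) \<le> 2 powr (p - 1) * (2 * (v * s powr (p - 1)))"
    by (intro mult_left_mono) auto
  moreover have "2 powr (p - 1) * (\<mu> * (\<mu> / 2) powr (p - 1)) = \<mu> powr p"
    using mu by (simp add: powr_divide powr_diff)
  moreover have "2 powr (p - 1) * (2 * (v * s powr (p - 1))) = 2 powr p * (v * s powr (p - 1))"
    by (simp add: powr_diff)
  ultimately have "ennreal (\<mu> powr p) \<le> ennreal (2 powr p * (v * s powr (p - 1)))"
    by (intro ennreal_leI) simp
  also have "\<dots> = ennreal (2 powr p) * (emeasure W E * enn_powr (emeasure S E) (p - 1))"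
    using v real by (simp add: ennreal_mult enn_powr_ennreal)
  finally show ?thesis by (simp add: \<mu>_def)
next
  case top
  then show ?thesis using W by (simp add: ennreal_mult_top)
qed

text \<open>Test A_p on \<open>Q\<close> with the indicator of \<open>E\<close>: the average is
  \<open>1 / D\<close>.\<close>

lemma Ap_on_doubling:
  assumes ap: "Ap_on c Q" and Q: "Q \<in> sets lebesgue" and E: "E \<in> sets lebesgue" and sub: "E \<subseteq> Q"
    and m: "0 < measure lebesgue E" and D0: "0 < D" and D: "measure lebesgue Q = D * measure lebesgue E" and c: "0 \<le> c"
  shows "emeasure W Q \<le> ennreal (c * D powr p) * emeasure W E"
proof -
  define \<mu> where "\<mu> = measure lebesgue E"
  have em: "emeasure lebesgue E = ennreal \<mu>"
    using m unfolding \<mu>_def by (metis emeasure_eq_ennreal_measure less_irrefl measure_zero_top)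
  have mu: "0 < \<mu>" using m by (simp add: \<mu>_def)
  have "enn_powr (ennreal (1 / measure lebesgue Q) * emeasure lebesgue (Q \<inter> E)) p * emeasure W Q \<le> ennreal c * emeasure W (Q \<inter> E)"
    by (rule Ap_on_indicator[OF ap Q E])
  moreover have "Q \<inter> E = E" using sub by blast
  moreover have "ennreal (1 / measure lebesgue Q) * emeasure lebesgue E = ennreal (1 / D)"
    using D mu D0 by (simp add: em flip: \<mu>_def ennreal_mult)
  ultimately have "ennreal (D powr p) * (ennreal ((1 / D) powr p) * emeasure W Q) \<le> ennreal (D powr p) * (ennreal c * emeasure W E)"
    using D0 by (intro mult_left_mono) (auto simp: enn_powr_ennreal)
  moreover have "ennreal (D powr p) * ennreal ((1 / D) powr p) = 1"
    using D0 by (simp add: powr_divide flip: ennreal_mult)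
  ultimately show ?thesis
    using c by (simp add: ennreal_mult mult_ac flip: mult.assoc)
qed

text \<open>The product form of A_p bounds the product of the two measures on \<open>Q\<close> from
  above, \<open>measure_powr_le\<close> bounds it on \<open>E\<close> from below. Since
  \<open>W\<close> of \<open>E\<close> is at most \<open>W\<close> of \<open>Q\<close>, the factor
  \<open>W\<close> of \<open>Q\<close> cancels, being neither 0 nor \<open>top\<close>, and a root
  of order \<open>p - 1\<close> remains.\<close>

lemma Ap_on_dual_doubling:
  assumes ap: "Ap_on c Q" and Q: "Q \<in> sets lebesgue" and E: "E \<in> sets lebesgue" and sub: "E \<subseteq> Q"
    and m: "0 < measure lebesgue E" and D0: "0 < D" and D: "measure lebesgue Q = D * measure lebesgue E" and c: "0 \<le> c"
    and W: "emeasure W Q \<noteq> 0" "emeasure W Q \<noteq> top"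
  shows "emeasure S Q \<le> ennreal ((c * (2 * D) powr p) powr (1 / (p - 1))) * emeasure S E"
proof -
  have mQ: "0 < measure lebesgue Q" using D D0 m by simp
  have pos: "AE x in lebesgue. x \<in> Q \<longrightarrow> 0 < w x"
    using W by (intro Ap_on_pos_AE[OF ap Q mQ]) (auto simp: zero_less_iff_neq_zero)
  have WEQ: "emeasure W E \<le> emeasure W Q"
    using sub Q by (intro emeasure_mono) auto
  have WE0: "emeasure W E \<noteq> 0"
  proof
    assume "emeasure W E = 0"
    then have "emeasure W Q \<le> 0"
      using Ap_on_doubling[OF ap Q E sub m D0 D c] by simp
    then show False using W by simp
  qed
  have *: "ennreal (measure lebesgue E powr p) \<le> ennreal (2 powr p) * (emeasure W E * enn_powr (emeasure S E) (p - 1))"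
  proof (rule measure_powr_le[OF E m _ WE0])
    show "AE x in lebesgue. x \<in> E \<longrightarrow> 0 < w x"
      using pos by eventually_elim (use sub in auto)
    show "emeasure W E \<noteq> top"
      using WEQ W by (auto simp: top_unique)
  qed
  have "emeasure W Q * enn_powr (emeasure S Q) (p - 1) \<le> ennreal c * ennreal (measure lebesgue Q powr p)"
    by (rule Ap_on_dual[OF ap Q mQ c])
  also have "\<dots> = ennreal (c * D powr p) * ennreal (measure lebesgue E powr p)"
    using D D0 m c by (simp add: powr_mult mult_ac flip: ennreal_mult)
  also have "\<dots> \<le> ennreal (c * D powr p) * (ennreal (2 powr p) * (emeasure W Q * enn_powr (emeasure S E) (p - 1)))"
    using WEQ by (intro mult_left_mono order_trans[OF *] mult_right_mono) auto
  also have "\<dots> = emeasure W Q * ((ennreal (c * D powr p) * ennreal (2 powr p)) * enn_powr (emeasure S E) (p - 1))"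
    by (simp only: mult_ac)
  also have "ennreal (c * D powr p) * ennreal (2 powr p) = ennreal (c * (2 * D) powr p)"
    using D0 c by (simp add: powr_mult mult_ac flip: ennreal_mult)
  finally have "enn_powr (emeasure S Q) (p - 1) \<le> ennreal (c * (2 * D) powr p) * enn_powr (emeasure S E) (p - 1)"
    using W by (simp add: ennreal_mult_le_mult_iff)
  then have "emeasure S Q \<le> enn_powr (ennreal (c * (2 * D) powr p) * enn_powr (emeasure S E) (p - 1)) (1 / (p - 1))"
    using p_gt_1 by (simp add: enn_powr_le_iff)
  also have "\<dots> = ennreal ((c * (2 * D) powr p) powr (1 / (p - 1))) * emeasure S E"
    using p_gt_1 c by (simp add: enn_powr_mult enn_powr_powr enn_powr_ennreal)
  finally show ?thesis .
qed

text \<open>Lerner's pointwise estimate for one cube. The average of \<open>f\<close> is the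
  \<open>S\<close> average of \<open>f / dual\<close> times \<open>S(Q) / |Q|\<close>. Raise this to
  the power \<open>p - 1\<close> and use A_p as
  \<open>(S(Q) / |Q|) powr (p - 1) \<le> c * |Q| / W(Q)\<close>. The factor \<open>|Q|\<close> is
  then the \<open>W\<close> integral of \<open>1 / w\<close> over \<open>Q\<close>, and the
  \<open>S\<close> average is at most the \<open>S\<close> maximal function at every point of
  \<open>Q\<close>, so it may be moved under that integral.\<close>

lemma average_le_wmax_wmax:
  assumes ap: "Ap_on c (qcube a l)" and c: "0 \<le> c" and l: "0 < l" and J: "(a, l) \<in> J"
    and W: "emeasure W (qcube a l) \<noteq> 0" "emeasure W (qcube a l) \<noteq> top"
    and f [measurable]: "f \<in> borel_measurable lebesgue" and f_nn: "\<And>x. 0 \<le> f x"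
    and J': "countable J"
    and x: "x \<in> qcube a l"
  shows "enn_powr ((\<integral>\<^sup>+y\<in>qcube a l. ennreal (f y) \<partial>lebesgue) / emeasure lebesgue (qcube a l)) (p - 1)
    \<le> ennreal c * wmax W J (\<lambda>y. enn_powr (wmax S J (\<lambda>z. ennreal (f z * w z powr (1 / (p - 1)))) y) (p - 1)
          * ennreal (1 / w y)) x"
proof -
  define Q where "Q = qcube a l"
  have Q [measurable]: "Q \<in> sets lebesgue" by (simp add: Q_def)
  define \<mu> where "\<mu> = measure lebesgue Q"
  have em: "emeasure lebesgue Q = ennreal \<mu>" and mu: "0 < \<mu>"
    unfolding \<mu>_def Q_def using l by (simp_all only: emeasure_qcube measure_qcube less_imp_le) simp
  define h where "h z = ennreal (f z * w z powr (1 / (p - 1)))" for z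
  define G where "G = wmax S J h"
  have [measurable]: "G \<in> borel_measurable lebesgue"
    using borel_measurable_wmax[OF J', of S h] by (simp add: G_def cong: measurable_cong_sets)
  have [measurable]: "h \<in> borel_measurable lebesgue"
    unfolding h_def[abs_def] by measurable
  define u where "u y = enn_powr (G y) (p - 1) * ennreal (1 / w y)" for y
  have [measurable]: "u \<in> borel_measurable lebesgue"
    unfolding u_def[abs_def] by measurable
  have pos: "AE x in lebesgue. x \<in> Q \<longrightarrow> 0 < w x"
    using W by (intro Ap_on_pos_AE[OF ap[folded Q_def] Q]) (use mu in \<open>auto simp: zero_less_iff_neq_zero Q_def \<mu>_def\<close>)
  obtain v where v: "emeasure W Q = ennreal v" "0 < v"
    using W by (cases "emeasure W Q") (auto simp: Q_def)
  have SQ: "emeasure W Q * enn_powr (emeasure S Q) (p - 1) \<le> ennreal c * ennreal (\<mu> powr p)"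
    unfolding \<mu>_def by (rule Ap_on_dual[OF ap[folded Q_def] Q _ c]) (use mu in \<open>simp add: \<mu>_def\<close>)
  have "emeasure S Q \<noteq> top"
  proof
    assume "emeasure S Q = top"
    then have "top \<le> ennreal c * ennreal (\<mu> powr p)"
      using SQ v by (simp add: ennreal_mult_top)
    then show False by (simp add: top_unique ennreal_mult_eq_top_iff)
  qed
  moreover have "ennreal (\<mu> powr p) \<le> ennreal (2 powr p) * (emeasure W Q * enn_powr (emeasure S Q) (p - 1))"
    unfolding \<mu>_def using W mu pos by (intro measure_powr_le[OF Q]) (auto simp: Q_def \<mu>_def)
  then have "emeasure S Q \<noteq> 0"
    using mu by auto
  ultimately obtain s where s: "emeasure S Q = ennreal s" "0 < s"
    by (cases "emeasure S Q") auto
  define F where "F = (\<integral>\<^sup>+y\<in>Q. ennreal (f y) \<partial>lebesgue)"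
  have hS: "(\<integral>\<^sup>+y\<in>Q. h y \<partial>S) = F"
  proof -
    have "(\<integral>\<^sup>+y\<in>Q. h y \<partial>S) = (\<integral>\<^sup>+y. ennreal (dual y) * (h y * indicator Q y) \<partial>lebesgue)"
      by (subst nn_integral_density) auto
    also have "\<dots> = F"
      unfolding F_def
    proof (rule nn_integral_cong_AE)
      show "AE y in lebesgue. ennreal (dual y) * (h y * indicator Q y) = ennreal (f y) * indicator Q y"
        using pos
      proof eventually_elim
        case (elim y)
        show ?case
        proof (cases "y \<in> Q")
          case True
          then have "0 < w y" using elim by simp
          then have "dual y * (f y * w y powr (1 / (p - 1))) = f y"
            by (simp add: dual_def flip: powr_add)
          then show ?thesis
            using f_nn[of y] by (simp add: h_def True dual_def flip: ennreal_mult)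
        qed simp
      qed
    qed
    finally show ?thesis .
  qed
  \<comment> \<open>The maximal function is uncentred: \<open>Q\<close> itself competes in the
    supremum at each of its points.\<close>
  have G_ge: "F / ennreal s \<le> G y" if "y \<in> Q" for y
    unfolding G_def wmax_def using J that
    by (intro SUP_upper2[of "(a, l)"]) (auto simp: Q_def[symmetric] hS s)
  \<comment> \<open>Lebesgue measure on \<open>Q\<close> is \<open>W\<close> with density
    \<open>1 / w\<close>; this is the reason for the factor \<open>1 / w y\<close> in
    \<open>u\<close>.\<close>
  have "enn_powr (F / ennreal s) (p - 1) * ennreal \<mu> = (\<integral>\<^sup>+y\<in>Q. enn_powr (F / ennreal s) (p - 1) \<partial>lebesgue)"
    by (simp add: nn_integral_cmult_indicator em)
  also have "\<dots> \<le> (\<integral>\<^sup>+y. ennreal (w y) * (u y * indicator Q y) \<partial>lebesgue)"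
  proof (rule nn_integral_mono_AE)
    show "AE y in lebesgue. enn_powr (F / ennreal s) (p - 1) * indicator Q y \<le> ennreal (w y) * (u y * indicator Q y)"
      using pos
    proof eventually_elim
      case (elim y)
      show ?case
      proof (cases "y \<in> Q")
        case True
        then have w: "0 < w y" using elim by simp
        have "ennreal (w y) * u y = enn_powr (G y) (p - 1) * (ennreal (w y) * ennreal (1 / w y))"
          by (simp add: u_def mult_ac)
        also have "ennreal (w y) * ennreal (1 / w y) = 1"
          using w by (simp flip: ennreal_mult)
        finally show ?thesis
          using True G_ge[OF True] p_gt_1 by (simp add: enn_powr_mono)
      qed simp
    qed
  qed
  also have "\<dots> = (\<integral>\<^sup>+y\<in>Q. u y \<partial>W)"
    by (subst nn_integral_density) auto
  finally have u: "enn_powr (F / ennreal s) (p - 1) * ennreal \<mu> \<le> (\<integral>\<^sup>+y\<in>Q. u y \<partial>W)" .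
  have M: "(\<integral>\<^sup>+y\<in>Q. u y \<partial>W) / ennreal v \<le> wmax W J u x"
    unfolding wmax_def using J x
    by (intro SUP_upper2[of "(a, l)"]) (auto simp: Q_def[symmetric] v)
  \<comment> \<open>The product form of A_p, solved for the power of \<open>1 / \<mu>\<close> that
    occurs in the average.\<close>
  have const: "(1 / \<mu>) powr (p - 1) \<le> c * ((1 / s) powr (p - 1) * \<mu> * (1 / v))"
  proof -
    have "v * s powr (p - 1) \<le> c * \<mu> powr p"
      using SQ s v c by (simp add: enn_powr_ennreal flip: ennreal_mult)
    also have "\<mu> powr p = \<mu> * \<mu> powr (p - 1)"
      using mu by (simp add: powr_diff)
    finally show ?thesis
      using mu s v by (simp add: powr_divide field_simps)
  qed
  have div: "F / ennreal r = F * ennreal (1 / r)" if "0 < r" for r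
    using that by (simp add: divide_ennreal_def inverse_ennreal inverse_eq_divide)
  have "enn_powr (F / emeasure lebesgue Q) (p - 1) = enn_powr F (p - 1) * ennreal ((1 / \<mu>) powr (p - 1))"
    using mu p_gt_1 by (simp add: em div enn_powr_mult enn_powr_ennreal)
  also have "\<dots> \<le> enn_powr F (p - 1) * ennreal (c * ((1 / s) powr (p - 1) * \<mu> * (1 / v)))"
    by (intro mult_left_mono ennreal_leI const) auto
  also have "\<dots> = ennreal c * ((enn_powr F (p - 1) * ennreal ((1 / s) powr (p - 1)) * ennreal \<mu>) * ennreal (1 / v))"
  proof -
    have "ennreal (c * ((1 / s) powr (p - 1) * \<mu> * (1 / v)))
        = ennreal c * (ennreal ((1 / s) powr (p - 1)) * ennreal \<mu> * ennreal (1 / v))"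
      using c mu v by (simp flip: ennreal_mult)
    then show ?thesis by (simp only: mult_ac)
  qed
  also have "enn_powr F (p - 1) * ennreal ((1 / s) powr (p - 1)) = enn_powr (F / ennreal s) (p - 1)"
    using s p_gt_1 by (simp add: div enn_powr_mult enn_powr_ennreal)
  also have "ennreal c * (enn_powr (F / ennreal s) (p - 1) * ennreal \<mu> * ennreal (1 / v))
      \<le> ennreal c * ((\<integral>\<^sup>+y\<in>Q. u y \<partial>W) * ennreal (1 / v))"
    by (intro mult_left_mono mult_right_mono u) auto
  also have "(\<integral>\<^sup>+y\<in>Q. u y \<partial>W) * ennreal (1 / v) = (\<integral>\<^sup>+y\<in>Q. u y \<partial>W) / ennreal v"
    using v by (simp add: divide_ennreal_def inverse_ennreal inverse_eq_divide)
  also have "ennreal c * \<dots> \<le> ennreal c * wmax W J u x"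
    by (intro mult_left_mono M) auto
  finally show ?thesis
    unfolding F_def Q_def u_def G_def h_def .
qed

text \<open>The pointwise estimate followed by two strong type bounds: exponent \<open>q\<close>,
  conjugate to \<open>p\<close>, for \<open>W\<close>, then exponent \<open>p\<close> for
  \<open>S\<close>. The exponents match because \<open>(p - 1) * q = p\<close>, and the weights
  because \<open>w * w powr (- q)\<close> is the dual weight. \<open>D\<close> is the volume ratio
  between a cube and its dilate by \<open>5 * sqrt n\<close>; it enters through the doubling
  constants of \<open>W\<close> and \<open>S\<close>.\<close>

lemma muckenhoupt_pos:
  fixes J :: "('a \<times> real) set"
  defines "D \<equiv> (5 * sqrt (real DIM('a))) ^ DIM('a)" and "q \<equiv> p / (p - 1)"
  assumes J: "countable J" and c: "0 \<le> c"
    and ap: "\<And>a l. (a, l) \<in> J \<Longrightarrow> 0 < l \<and> l \<le> B \<and> Ap_on c (qcube a l) \<and>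
      Ap_on c (qcube a (5 * (sqrt (real DIM('a)) * l))) \<and>
      emeasure W (qcube a (5 * (sqrt (real DIM('a)) * l))) \<noteq> top \<and> emeasure W (qcube a l) \<noteq> 0"
    and f [measurable]: "f \<in> borel_measurable lebesgue" and f_nn: "\<And>x. 0 \<le> f x"
  shows "(\<integral>\<^sup>+x. enn_powr (wmax lebesgue J (\<lambda>x. ennreal (f x)) x) p \<partial>W)
    \<le> ennreal (c powr q * (c * D powr p * (2 powr q * q / (q - 1))) *
        ((c * (2 * D) powr p) powr (1 / (p - 1)) * (2 powr p * p / (p - 1))))
      * (\<integral>\<^sup>+x. enn_powr (ennreal (f x)) p \<partial>W)"
proof -
  define s where "s = sqrt (real DIM('a))"
  have s1: "1 \<le> s" by (simp add: s_def Suc_leI)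
  have D: "1 \<le> D" unfolding D_def s_def[symmetric] using s1 by (intro one_le_power) auto
  have q: "1 < q" using p_gt_1 by (simp add: q_def)
  have pq: "(p - 1) * q = p" using p_gt_1 by (simp add: q_def)
  define h where "h z = ennreal (f z * w z powr (1 / (p - 1)))" for z
  define G where "G = wmax S J h"
  define u where "u y = enn_powr (G y) (p - 1) * ennreal (1 / w y)" for y
  have [measurable]: "G \<in> borel_measurable lebesgue"
    using borel_measurable_wmax[OF J, of S h] by (simp add: G_def cong: measurable_cong_sets)
  have [measurable]: "h \<in> borel_measurable lebesgue"
    unfolding h_def[abs_def] by measurable
  have [measurable]: "u \<in> borel_measurable lebesgue"
    unfolding u_def[abs_def] by measurable
  have Wm: "wmax W J u \<in> borel_measurable lebesgue"
    using borel_measurable_wmax[OF J, of W u] by (simp cong: measurable_cong_sets)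
  have cubes: "qcube a l \<subseteq> qcube a (5 * (s * l)) \<and> 0 < measure lebesgue (qcube a l) \<and>
      measure lebesgue (qcube a (5 * (s * l))) = D * measure lebesgue (qcube a l) \<and>
      emeasure W (qcube a (5 * (s * l))) \<noteq> 0 \<and> emeasure W (qcube a l) \<noteq> top" if "(a, l) \<in> J" for a l
  proof -
    have l: "0 < l" and W: "emeasure W (qcube a (5 * (s * l))) \<noteq> top" "emeasure W (qcube a l) \<noteq> 0"
      using ap[OF that] by (auto simp: s_def)
    have "1 * l \<le> 5 * (s * l)"
      using s1 l by (simp flip: mult.assoc)
    then have sub: "qcube a l \<subseteq> qcube a (5 * (s * l))"
      by (force simp: mem_qcube)
    have "emeasure W (qcube a l) \<le> emeasure W (qcube a (5 * (s * l)))"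
      by (intro emeasure_mono sub) auto
    moreover have "measure lebesgue (qcube a (5 * (s * l))) = D * measure lebesgue (qcube a l)"
    proof -
      have "(2 * (5 * (s * l))) ^ DIM('a) = (5 * s * (2 * l)) ^ DIM('a)"
        by (simp add: mult_ac)
      also have "\<dots> = D * (2 * l) ^ DIM('a)"
        unfolding D_def s_def[symmetric] by (rule power_mult_distrib)
      finally show ?thesis
        using l s1 measure_qcube[of l a] measure_qcube[of "5 * (s * l)" a] by simp
    qed
    moreover have "0 < measure lebesgue (qcube a l)"
      using l by (subst measure_qcube) auto
    ultimately show ?thesis using sub W by (auto simp: top_unique)
  qed
  have dblW: "0 < l \<and> l \<le> B \<and> emeasure W (cball a (5 * (sqrt (real DIM('a)) * l)))
      \<le> ennreal (c * D powr p) * emeasure W (qcube a l)" if J: "(a, l) \<in> J" for a l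
  proof -
    have "emeasure W (cball a (5 * (s * l))) \<le> emeasure W (qcube a (5 * (s * l)))"
      by (intro emeasure_mono cball_subset_qcube) auto
    also have "\<dots> \<le> ennreal (c * D powr p) * emeasure W (qcube a l)"
      using ap[OF J] cubes[OF J] c D by (intro Ap_on_doubling) (auto simp: s_def)
    finally show ?thesis using ap[OF J] by (simp add: s_def)
  qed
  have dblS: "0 < l \<and> l \<le> B \<and> emeasure S (cball a (5 * (sqrt (real DIM('a)) * l)))
      \<le> ennreal ((c * (2 * D) powr p) powr (1 / (p - 1))) * emeasure S (qcube a l)" if J: "(a, l) \<in> J" for a l
  proof -
    have "emeasure S (cball a (5 * (s * l))) \<le> emeasure S (qcube a (5 * (s * l)))"
      by (intro emeasure_mono cball_subset_qcube) auto
    also have "\<dots> \<le> ennreal ((c * (2 * D) powr p) powr (1 / (p - 1))) * emeasure S (qcube a l)"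
      using ap[OF J] cubes[OF J] c D by (intro Ap_on_dual_doubling) (auto simp: s_def)
    finally show ?thesis using ap[OF J] by (simp add: s_def)
  qed
  have pt: "enn_powr (wmax lebesgue J (\<lambda>x. ennreal (f x)) x) p
      \<le> ennreal (c powr q) * enn_powr (wmax W J u x) q" for x
  proof -
    have "enn_powr (wmax lebesgue J (\<lambda>x. ennreal (f x)) x) (p - 1) \<le> ennreal c * wmax W J u x"
      unfolding wmax_def[of lebesgue]
    proof (subst enn_powr_SUP, use p_gt_1 in simp, rule SUP_least, clarify)
      fix a l assume al: "(a, l) \<in> J"
      show "enn_powr (indicator (qcube a l) x * ((\<integral>\<^sup>+y\<in>qcube a l. ennreal (f y) \<partial>lebesgue) / emeasure lebesgue (qcube a l))) (p - 1)
        \<le> ennreal c * wmax W J u x"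
      proof (cases "x \<in> qcube a l")
        case True
        then show ?thesis
          using average_le_wmax_wmax[of c a l J f x] ap[OF al] cubes[OF al] al c J f_nn f
          by (simp add: u_def[abs_def] G_def h_def[abs_def])
      qed simp
    qed
    then have "enn_powr (enn_powr (wmax lebesgue J (\<lambda>x. ennreal (f x)) x) (p - 1)) q \<le> enn_powr (ennreal c * wmax W J u x) q"
      using q by (intro enn_powr_mono) auto
    then show ?thesis
      using q c by (simp add: enn_powr_powr pq enn_powr_mult enn_powr_ennreal)
  qed
  have "(\<integral>\<^sup>+x. enn_powr (wmax lebesgue J (\<lambda>x. ennreal (f x)) x) p \<partial>W)
      \<le> (\<integral>\<^sup>+x. ennreal (c powr q) * enn_powr (wmax W J u x) q \<partial>W)"
    by (intro nn_integral_mono pt)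
  also have "\<dots> = ennreal (c powr q) * (\<integral>\<^sup>+x. enn_powr (wmax W J u x) q \<partial>W)"
    using Wm by (intro nn_integral_cmult) (auto cong: measurable_cong_sets)
  also have "\<dots> \<le> ennreal (c powr q) * (ennreal (c * D powr p) * ennreal (2 powr q * q / (q - 1)) * (\<integral>\<^sup>+x. enn_powr (u x) q \<partial>W))"
    by (intro mult_left_mono wmax_strong_type[OF J _ sigma_finite_W dblW _ q]) auto
  also have "(\<integral>\<^sup>+x. enn_powr (u x) q \<partial>W) \<le> (\<integral>\<^sup>+x. enn_powr (G x) p \<partial>S)"
  proof -
    \<comment> \<open>Here \<open>1 - q = - 1 / (p - 1)\<close>, so the weight of the
      \<open>L\<^sup>q\<close> norm of \<open>u\<close> turns into that of the
      \<open>L\<^sup>p\<close> norm of \<open>G\<close>.\<close>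
    have "ennreal (w x) * enn_powr (u x) q \<le> ennreal (dual x) * enn_powr (G x) p" for x
    proof (cases "w x = 0")
      case False
      then have w: "0 < w x" using w_nonneg[of x] by simp
      have "w x * (1 / w x) powr q = w x powr (1 - q)"
        using w by (simp add: powr_divide powr_diff)
      also have "1 - q = - 1 / (p - 1)"
        using p_gt_1 by (simp add: q_def field_simps)
      finally have e: "ennreal (w x) * ennreal ((1 / w x) powr q) = ennreal (dual x)"
        using w by (simp add: dual_def flip: ennreal_mult)
      have "enn_powr (u x) q = enn_powr (G x) p * ennreal ((1 / w x) powr q)"
        using w q by (simp add: u_def enn_powr_mult enn_powr_powr pq enn_powr_ennreal)
      then have "ennreal (w x) * enn_powr (u x) q = (ennreal (w x) * ennreal ((1 / w x) powr q)) * enn_powr (G x) p"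
        by (simp only: mult_ac)
      then show ?thesis by (simp only: e order_refl)
    qed simp
    then show ?thesis
      by (subst (1 2) nn_integral_density) (auto intro!: nn_integral_mono)
  qed
  also have "(\<integral>\<^sup>+x. enn_powr (G x) p \<partial>S) \<le> ennreal ((c * (2 * D) powr p) powr (1 / (p - 1))) * ennreal (2 powr p * p / (p - 1)) * (\<integral>\<^sup>+x. enn_powr (h x) p \<partial>S)"
    unfolding G_def by (intro wmax_strong_type[OF J _ sigma_finite_S dblS _ p_gt_1]) auto
  also have "(\<integral>\<^sup>+x. enn_powr (h x) p \<partial>S) \<le> (\<integral>\<^sup>+x. enn_powr (ennreal (f x)) p \<partial>W)"
  proof -
    have "ennreal (dual x) * enn_powr (h x) p = ennreal (w x) * enn_powr (ennreal (f x)) p" for x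
    proof (cases "w x = 0")
      case False
      then have w: "0 < w x" using w_nonneg[of x] by simp
      have "dual x * (w x powr (1 / (p - 1))) powr p = w x powr (- 1 / (p - 1) + p / (p - 1))"
        using powr_add[of "w x" "- 1 / (p - 1)" "p / (p - 1)"] by (simp add: dual_def powr_powr)
      also have "- 1 / (p - 1) + p / (p - 1) = (- 1 + p) / (p - 1)"
        by (rule add_divide_distrib[symmetric])
      also have "\<dots> = 1" using p_gt_1 by simp
      finally have "dual x * (f x * w x powr (1 / (p - 1))) powr p = w x * f x powr p"
        using w f_nn[of x] by (simp add: powr_mult mult_ac)
      then show ?thesis
        using f_nn[of x] w_nonneg[of x]
        by (simp add: h_def enn_powr_ennreal dual_def flip: ennreal_mult)
    qed (simp add: dual_def)
    then show ?thesis
      by (subst (1 2) nn_integral_density) auto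
  qed
  finally show ?thesis
  proof (rule order_trans[OF _ eq_refl])
    have e: "ennreal (c powr q * (c * D powr p * (2 powr q * q / (q - 1))) *
        ((c * (2 * D) powr p) powr (1 / (p - 1)) * (2 powr p * p / (p - 1))))
      = ennreal (c powr q) * (ennreal (c * D powr p) * ennreal (2 powr q * q / (q - 1))) *
        (ennreal ((c * (2 * D) powr p) powr (1 / (p - 1))) * ennreal (2 powr p * p / (p - 1)))"
      using c q p_gt_1 by (simp flip: ennreal_mult)
    show "ennreal (c powr q) * (ennreal (c * D powr p) * ennreal (2 powr q * q / (q - 1)) *
        (ennreal ((c * (2 * D) powr p) powr (1 / (p - 1))) * ennreal (2 powr p * p / (p - 1)) *
        (\<integral>\<^sup>+x. enn_powr (ennreal (f x)) p \<partial>W)))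
      = ennreal (c powr q * (c * D powr p * (2 powr q * q / (q - 1))) *
        ((c * (2 * D) powr p) powr (1 / (p - 1)) * (2 powr p * p / (p - 1)))) * (\<integral>\<^sup>+x. enn_powr (ennreal (f x)) p \<partial>W)"
      unfolding e by (simp only: mult_ac)
  qed (auto intro!: mult_left_mono)
qed

text \<open>\<open>C\<close> is fixed before \<open>J\<close>, \<open>B\<close> and
  \<open>f\<close>, so one constant serves all Whitney cubes later on. Cubes of \<open>W\<close>
  measure 0, on which the pointwise estimate would divide by 0, are removed from \<open>J\<close>:
  their countable union is \<open>W\<close> null, and off it the maximal function is
  unchanged.\<close>

theorem muckenhoupt:
  assumes c: "0 \<le> c"
  obtains C where "0 \<le> C" and "\<And>(J :: ('a \<times> real) set) B (f :: 'a \<Rightarrow> real). countable J \<Longrightarrow>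
    (\<And>a l. (a, l) \<in> J \<Longrightarrow> 0 < l \<and> l \<le> B \<and> Ap_on c (qcube a l) \<and>
      Ap_on c (qcube a (5 * (sqrt (real DIM('a)) * l))) \<and>
      emeasure W (qcube a (5 * (sqrt (real DIM('a)) * l))) \<noteq> top) \<Longrightarrow>
    f \<in> borel_measurable lebesgue \<Longrightarrow> (\<And>x. 0 \<le> f x) \<Longrightarrow>
    (\<integral>\<^sup>+x. enn_powr (wmax lebesgue J (\<lambda>x. ennreal (f x)) x) p \<partial>W)
      \<le> ennreal C * (\<integral>\<^sup>+x. enn_powr (ennreal (f x)) p \<partial>W)"
proof -
  define q where "q = p / (p - 1)"
  define D where "D = (5 * sqrt (real DIM('a))) ^ DIM('a)"
  define C where "C = c powr q * (c * D powr p * (2 powr q * q / (q - 1))) *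
        ((c * (2 * D) powr p) powr (1 / (p - 1)) * (2 powr p * p / (p - 1)))"
  have q: "1 < q" using p_gt_1 by (simp add: q_def)
  have C: "0 \<le> C"
    unfolding C_def using c q p_gt_1 by (intro mult_nonneg_nonneg divide_nonneg_nonneg) auto
  show ?thesis
  proof (rule that[OF C])
    fix J :: "('a \<times> real) set" and B and f :: "'a \<Rightarrow> real"
    assume J: "countable J" and f: "f \<in> borel_measurable lebesgue" "\<And>x. 0 \<le> f x"
      and ap: "\<And>a l. (a, l) \<in> J \<Longrightarrow> 0 < l \<and> l \<le> B \<and> Ap_on c (qcube a l) \<and>
      Ap_on c (qcube a (5 * (sqrt (real DIM('a)) * l))) \<and>
      emeasure W (qcube a (5 * (sqrt (real DIM('a)) * l))) \<noteq> top"
    define J' where "J' = {(a, l)\<in>J. emeasure W (qcube a l) \<noteq> 0}"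
    have J': "countable J'"
      by (rule countable_subset[OF _ J]) (auto simp: J'_def)
    define N where "N = (\<Union>(a, l)\<in>J - J'. qcube a l)"
    have "N \<in> null_sets W"
      unfolding N_def using J by (intro null_sets_UN') (auto simp: J'_def null_sets_def)
    then have "AE x in W. x \<notin> N"
      by (rule AE_not_in)
    then have "AE x in W. enn_powr (wmax lebesgue J (\<lambda>x. ennreal (f x)) x) p
        \<le> enn_powr (wmax lebesgue J' (\<lambda>x. ennreal (f x)) x) p"
    proof eventually_elim
      case (elim x)
      have "wmax lebesgue J (\<lambda>x. ennreal (f x)) x \<le> wmax lebesgue J' (\<lambda>x. ennreal (f x)) x"
        unfolding wmax_def
      proof (rule SUP_least, clarify)
        fix a l assume al: "(a, l) \<in> J"
        show "indicator (qcube a l) x * ((\<integral>\<^sup>+y\<in>qcube a l. ennreal (f y) \<partial>lebesgue) / emeasure lebesgue (qcube a l))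
          \<le> (SUP (a, l)\<in>J'. indicator (qcube a l) x *
              ((\<integral>\<^sup>+y\<in>qcube a l. ennreal (f y) \<partial>lebesgue) / emeasure lebesgue (qcube a l)))"
        proof (cases "x \<in> qcube a l")
          case True
          then have "(a, l) \<in> J'" using elim al by (auto simp: N_def)
          then show ?thesis by (intro SUP_upper2[of "(a, l)"]) auto
        qed simp
      qed
      then show ?case using p_gt_1 by (intro enn_powr_mono) auto
    qed
    then have "(\<integral>\<^sup>+x. enn_powr (wmax lebesgue J (\<lambda>x. ennreal (f x)) x) p \<partial>W)
        \<le> (\<integral>\<^sup>+x. enn_powr (wmax lebesgue J' (\<lambda>x. ennreal (f x)) x) p \<partial>W)"
      by (rule nn_integral_mono_AE)
    also have "\<dots> \<le> ennreal C * (\<integral>\<^sup>+x. enn_powr (ennreal (f x)) p \<partial>W)"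
      unfolding C_def q_def D_def using ap
      by (intro muckenhoupt_pos[OF J' c _ f]) (auto simp: J'_def)
    finally show "(\<integral>\<^sup>+x. enn_powr (wmax lebesgue J (\<lambda>x. ennreal (f x)) x) p \<partial>W)
      \<le> ennreal C * (\<integral>\<^sup>+x. enn_powr (ennreal (f x)) p \<partial>W)" .
  qed
qed

end

subsection \<open>Whitney cubes\<close>

lemma cubes_eq_qcube: "cubes = {qcube (a :: 'a::euclidean_space) l | a l. 0 < l}"
proof -
  have d: "(2 * l) *\<^sub>R (One :: 'a) = l *\<^sub>R One + l *\<^sub>R One" for l :: real
    by (metis mult_2 scaleR_add_left)
  have 1: "cbox a (a + l *\<^sub>R One) = qcube (a + (l / 2) *\<^sub>R One) (l / 2)" for a :: 'a and l
    using d[of "l / 2"] by (simp add: qcube_def add.assoc)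
  have 2: "qcube a l = cbox (a - l *\<^sub>R One) (a - l *\<^sub>R One + (2 * l) *\<^sub>R One)" for a :: 'a and l
    unfolding d by (simp add: qcube_def)
  show ?thesis
  proof (intro equalityI subsetI)
    fix Q :: "'a set" assume "Q \<in> cubes"
    then obtain a l where "Q = cbox a (a + l *\<^sub>R One)" "0 < l" by (auto simp: cubes_def)
    then show "Q \<in> {qcube a l | a l. 0 < l}"
      using 1[of a l] half_gt_zero[of l] by blast
  next
    fix Q :: "'a set" assume "Q \<in> {qcube a l | a l. 0 < l}"
    then obtain a l where "Q = qcube a l" "0 < 2 * l" by auto
    then show "Q \<in> cubes"
      unfolding cubes_def using 2[of a l] by blast
  qed
qed

lemma qcube_in_cubes: "0 < l \<Longrightarrow> qcube a l \<in> cubes"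
  by (auto simp: cubes_eq_qcube)

lemma center_in_qcube [simp]: "0 \<le> l \<Longrightarrow> a \<in> qcube a l"
  by (simp add: mem_qcube)

lemma qcube_nonempty [simp]: "0 \<le> l \<Longrightarrow> qcube a l \<noteq> {}"
  using center_in_qcube by blast

lemma qcube_subset_qcube:
  assumes "dist a b + l \<le> m"
  shows "qcube a l \<subseteq> qcube b m"
proof
  fix x assume x: "x \<in> qcube a l"
  show "x \<in> qcube b m"
    unfolding mem_qcube
  proof
    fix i :: 'a assume i: "i \<in> Basis"
    have "\<bar>a \<bullet> i - b \<bullet> i\<bar> \<le> dist a b"
      using Basis_le_norm[OF i, of "a - b"] by (simp add: inner_diff_left dist_norm)
    moreover have "\<bar>x \<bullet> i - a \<bullet> i\<bar> \<le> l"
      using x i by (simp add: mem_qcube)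
    ultimately show "\<bar>x \<bullet> i - b \<bullet> i\<bar> \<le> m" using assms by linarith
  qed
qed

lemma qcube_mono: "l \<le> m \<Longrightarrow> qcube a l \<subseteq> qcube a m"
  by (rule qcube_subset_qcube) simp

lemma qcube_meet_subset:
  assumes "x \<in> qcube a l" "x \<in> qcube b k"
  shows "qcube b k \<subseteq> qcube a (l + 2 * k)"
proof
  fix y assume y: "y \<in> qcube b k"
  show "y \<in> qcube a (l + 2 * k)"
    unfolding mem_qcube
  proof
    fix i :: 'a assume i: "i \<in> Basis"
    have "\<bar>x \<bullet> i - a \<bullet> i\<bar> \<le> l" "\<bar>x \<bullet> i - b \<bullet> i\<bar> \<le> k" "\<bar>y \<bullet> i - b \<bullet> i\<bar> \<le> k"
      using assms y i by (auto simp: mem_qcube)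
    then show "\<bar>y \<bullet> i - a \<bullet> i\<bar> \<le> l + 2 * k" by linarith
  qed
qed

section \<open>Distances to \<open>\<Omega>\<close> from cubes and from their points\<close>

lemma dist_le_qcube:
  fixes a :: "'a::euclidean_space"
  shows "x \<in> qcube a l \<Longrightarrow> dist a x \<le> sqrt (real DIM('a)) * l"
  using qcube_subset_cball[of a l] by auto

lemma diameter_qcube:
  fixes a :: "'a::euclidean_space"
  assumes "0 \<le> l"
  shows "diameter (qcube a l) = 2 * sqrt (real DIM('a)) * l"
proof -
  have "diameter (qcube a l) = dist (a - l *\<^sub>R One) (a + l *\<^sub>R One)"
    unfolding qcube_def using assms
    by (intro diameter_cbox) (simp add: inner_diff_left inner_add_left)
  also have "\<dots> = norm ((2 * l) *\<^sub>R (One :: 'a))"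
  proof -
    have "a - l *\<^sub>R One - (a + l *\<^sub>R One) = - ((2 * l) *\<^sub>R One)"
      using scaleR_add_left[of l l "One :: 'a"] by (simp add: algebra_simps)
    then show ?thesis
      by (simp only: dist_norm norm_minus_cancel)
  qed
  also have "\<dots> = 2 * l * norm (One :: 'a)"
    using assms by simp
  also have "norm (One :: 'a) = sqrt (real DIM('a))"
    by (simp add: norm_eq_sqrt_inner inner_sum_left inner_sum_right inner_Basis)
  finally show ?thesis by simp
qed

lemma infdist_diff_le_qcube:
  fixes a :: "'a::euclidean_space"
  assumes "x \<in> qcube a l"
  shows "\<bar>infdist x \<Omega> - infdist a \<Omega>\<bar> \<le> sqrt (real DIM('a)) * l"
  using infdist_triangle_abs[of a \<Omega> x] dist_le_qcube[OF assms] by linarith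

text \<open>Contract the larger cube towards its centre: each point moves by at most
  \<open>sqrt n * (t - t')\<close>. This supplies continuity in the half side for the intermediate
  value argument, and at \<open>t' = 0\<close> it compares a cube with its centre.\<close>

lemma setdist_qcube_Lipschitz:
  fixes x :: "'a::euclidean_space"
  assumes ne: "\<Omega> \<noteq> {}" and t: "0 \<le> t'" "t' \<le> t"
  shows "setdist (qcube x t') \<Omega> \<le> setdist (qcube x t) \<Omega> + sqrt (real DIM('a)) * (t - t')"
proof (cases "t = 0")
  case False
  then have t0: "0 < t" using t by simp
  have "setdist (qcube x t') \<Omega> - sqrt (real DIM('a)) * (t - t') \<le> setdist (qcube x t) \<Omega>"
  proof (rule le_setdistI)
    show "qcube x t \<noteq> {}" using t0 by simp
    fix y z assume y: "y \<in> qcube x t" and z: "z \<in> \<Omega>"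
    define y' where "y' = x + (t' / t) *\<^sub>R (y - x)"
    have "y' \<in> qcube x t'"
      unfolding mem_qcube
    proof
      fix i :: 'a assume i: "i \<in> Basis"
      have "\<bar>y' \<bullet> i - x \<bullet> i\<bar> = (t' / t) * \<bar>y \<bullet> i - x \<bullet> i\<bar>"
        using t t0 by (simp add: y'_def inner_add_left inner_diff_left abs_mult)
      also have "\<dots> \<le> (t' / t) * t"
        using y i t t0 by (intro mult_left_mono) (auto simp: mem_qcube)
      finally show "\<bar>y' \<bullet> i - x \<bullet> i\<bar> \<le> t'" using t0 by simp
    qed
    then have "setdist (qcube x t') \<Omega> \<le> dist y' z"
      using z by (intro setdist_le_dist)
    also have "\<dots> \<le> dist y' y + dist y z" by (rule dist_triangle)
    also have "dist y' y = (1 - t' / t) * dist x y"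
    proof -
      have "y - y' = (1 - t' / t) *\<^sub>R (y - x)"
        by (simp add: y'_def algebra_simps)
      moreover have "0 \<le> 1 - t' / t" using t t0 by simp
      ultimately show ?thesis
        by (metis dist_commute dist_norm norm_scaleR abs_of_nonneg)
    qed
    also have "\<dots> \<le> (1 - t' / t) * (sqrt (real DIM('a)) * t)"
      using dist_le_qcube[OF y] t t0 by (intro mult_left_mono) auto
    also have "\<dots> = sqrt (real DIM('a)) * (t - t')"
      using t0 by (simp add: field_simps)
    finally show "setdist (qcube x t') \<Omega> - sqrt (real DIM('a)) * (t - t') \<le> dist y z"
      by simp
  qed (use ne in auto)
  then show ?thesis by simp
qed (use t in auto)

lemma qcube_0 [simp]: "qcube x 0 = {x}"
  by (simp add: qcube_def)

lemma infdist_center_le: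
  fixes x :: "'a::euclidean_space"
  assumes "\<Omega> \<noteq> {}" "0 \<le> t"
  shows "infdist x \<Omega> \<le> setdist (qcube x t) \<Omega> + sqrt (real DIM('a)) * t"
  using setdist_qcube_Lipschitz[OF assms(1), of 0 t x] assms(2) by (simp add: infdist_eq_setdist)

lemma setdist_qcube_le_infdist: "y \<in> qcube x t \<Longrightarrow> setdist (qcube x t) \<Omega> \<le> infdist y \<Omega>"
  unfolding infdist_eq_setdist by (rule setdist_le_sing)

text \<open>The intermediate value theorem yields a half side for which the distance is exactly
  \<open>r1\<close> times the diameter, the lower edge of the admissible range. With this equality
  the half side is comparable to \<open>infdist x \<Omega>\<close> with constants in
  \<open>r1\<close> and the dimension alone.\<close>

lemma whitney_qcube_exists:
  fixes x :: "'a::euclidean_space"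
  assumes \<Omega>: "closed \<Omega>" "\<Omega> \<noteq> {}" and x: "0 < infdist x \<Omega>" and r: "0 < r1" "r1 < r2"
  obtains t where "0 < t" "qcube x t \<in> whitney_family \<Omega> r1 r2"
    "infdist x \<Omega> \<le> (2 * r1 + 1) * (sqrt (real DIM('a)) * t)"
    "2 * r1 * (sqrt (real DIM('a)) * t) \<le> infdist x \<Omega>"
proof -
  define s where "s = sqrt (real DIM('a))"
  have s: "0 < s" by (simp add: s_def)
  \<comment> \<open>The distance of the cube is at most that of its centre, so at this half side
    \<open>2 * r1 * s * T\<close> has already caught up with it.\<close>
  define T where "T = infdist x \<Omega> / (2 * r1 * s)"
  have T: "0 < T" using x r s by (simp add: T_def)
  define \<phi> where "\<phi> t = setdist (qcube x t) \<Omega> - 2 * r1 * s * t" for t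
  have "s-lipschitz_on {0..T} (\<lambda>t. setdist (qcube x t) \<Omega>)"
  proof (rule lipschitz_onI)
    fix u v :: real assume uv: "u \<in> {0..T}" "v \<in> {0..T}"
    have mono: "setdist (qcube x m) \<Omega> \<le> setdist (qcube x l) \<Omega>" if "0 \<le> l" "l \<le> m" for l m
      using that by (intro setdist_subset_left qcube_mono) auto
    show "dist (setdist (qcube x u) \<Omega>) (setdist (qcube x v) \<Omega>) \<le> s * dist u v"
    proof (cases "u \<le> v")
      case True
      then show ?thesis
        using uv mono[of u v] setdist_qcube_Lipschitz[OF \<Omega>(2), of u v x]
        by (auto simp: dist_real_def s_def)
    next
      case False
      then show ?thesis
        using uv mono[of v u] setdist_qcube_Lipschitz[OF \<Omega>(2), of v u x]
        by (auto simp: dist_real_def s_def)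
    qed
  qed (use s in simp)
  then have "continuous_on {0..T} \<phi>"
    unfolding \<phi>_def by (intro continuous_intros lipschitz_on_continuous_on)
  moreover have "\<phi> 0 > 0"
    using x by (simp add: \<phi>_def infdist_eq_setdist)
  moreover have "\<phi> T \<le> 0"
    using setdist_qcube_le_infdist[of x x T \<Omega>] T r s by (simp add: \<phi>_def T_def)
  ultimately obtain t where t: "0 \<le> t" "t \<le> T" "\<phi> t = 0"
    using IVT2'[of \<phi> T 0 0] T by auto
  then have t0: "0 < t" using \<open>\<phi> 0 > 0\<close> by (cases "t = 0") auto
  have sd: "setdist (qcube x t) \<Omega> = r1 * diameter (qcube x t)"
    using t t0 by (simp add: diameter_qcube \<phi>_def s_def)
  show ?thesis
  proof (rule that[OF t0])
    have "r1 * diameter (qcube x t) \<le> r2 * diameter (qcube x t)"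
      using r t0 by (intro mult_right_mono) (auto simp: diameter_qcube)
    then show "qcube x t \<in> whitney_family \<Omega> r1 r2"
      unfolding whitney_family_def using sd t0 by (auto simp: qcube_in_cubes)
    show "infdist x \<Omega> \<le> (2 * r1 + 1) * (sqrt (real DIM('a)) * t)"
      using infdist_center_le[OF \<Omega>(2), of t x] sd t0 by (simp add: diameter_qcube algebra_simps)
    show "2 * r1 * (sqrt (real DIM('a)) * t) \<le> infdist x \<Omega>"
      using setdist_qcube_le_infdist[of x x t \<Omega>] sd t0 by (simp add: diameter_qcube)
  qed
qed

text \<open>In the upper bound \<open>r2\<close> accounts for the distance of the cube, and the
  added 1 for the two passages through the centre, each costing at most
  \<open>sqrt n * k\<close>.\<close>

lemma whitney_qcube_infdist:
  fixes b :: "'a::euclidean_space"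
  assumes P: "qcube b k \<in> whitney_family \<Omega> r1 r2" and k: "0 < k" and \<Omega>: "\<Omega> \<noteq> {}" and y: "y \<in> qcube b k"
  shows "2 * r1 * (sqrt (real DIM('a)) * k) \<le> infdist y \<Omega>"
    and "infdist y \<Omega> \<le> 2 * (r2 + 1) * (sqrt (real DIM('a)) * k)"
proof -
  have sd: "r1 * (2 * sqrt (real DIM('a)) * k) \<le> setdist (qcube b k) \<Omega>"
      "setdist (qcube b k) \<Omega> \<le> r2 * (2 * sqrt (real DIM('a)) * k)"
    using P k by (auto simp: whitney_family_def diameter_qcube)
  show "2 * r1 * (sqrt (real DIM('a)) * k) \<le> infdist y \<Omega>"
    using setdist_qcube_le_infdist[OF y, of \<Omega>] sd by (simp add: mult_ac)
  show "infdist y \<Omega> \<le> 2 * (r2 + 1) * (sqrt (real DIM('a)) * k)"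
    using infdist_diff_le_qcube[OF y, of \<Omega>] infdist_center_le[OF \<Omega>, of k b] k sd
    by (simp add: algebra_simps)
qed

lemma whitney_familyE:
  assumes "P \<in> whitney_family \<Omega> r1 r2"
  obtains b k where "P = qcube b k" "0 < k"
  using assms by (auto simp: whitney_family_def cubes_eq_qcube)

text \<open>Compactness is used once, at scale 1 around the origin, and the cover is then translated
  and scaled. Thus the number of pieces does not depend on \<open>b\<close> or
  \<open>k\<close>.\<close>

lemma qcube_finite_cover:
  assumes "0 < \<delta>"
  obtains Z :: "'a::euclidean_space set" where "finite Z" "\<And>b k. 0 < k \<Longrightarrow> qcube b (k * R) \<subseteq> (\<Union>z\<in>Z. qcube (b + k *\<^sub>R z) (k * \<delta>))"
proof -
  have "compact (qcube (0 :: 'a) R)" by (simp add: qcube_def)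
  moreover have "qcube (0 :: 'a) R \<subseteq> \<Union>((\<lambda>z. ball z \<delta>) ` qcube 0 R)"
    using assms by auto
  moreover have "\<And>T. T \<in> (\<lambda>z. ball z \<delta>) ` qcube (0 :: 'a) R \<Longrightarrow> open T" by auto
  ultimately obtain \<C> where C: "\<C> \<subseteq> (\<lambda>z. ball z \<delta>) ` qcube (0 :: 'a) R" "finite \<C>" "qcube (0 :: 'a) R \<subseteq> \<Union>\<C>"
    by (rule compactE)
  then obtain Z where Z: "Z \<subseteq> qcube (0 :: 'a) R" "finite Z" "\<C> = (\<lambda>z. ball z \<delta>) ` Z"
    by (meson finite_subset_image)
  with C have cov: "qcube (0 :: 'a) R \<subseteq> (\<Union>z\<in>Z. ball z \<delta>)" by simp
  show ?thesis
  proof (rule that[OF Z(2)])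
    fix b :: 'a and k :: real assume k: "0 < k"
    show "qcube b (k * R) \<subseteq> (\<Union>z\<in>Z. qcube (b + k *\<^sub>R z) (k * \<delta>))"
    proof
      fix y assume y: "y \<in> qcube b (k * R)"
      define v where "v = (1 / k) *\<^sub>R (y - b)"
      have yv: "y = b + k *\<^sub>R v" using k by (simp add: v_def)
      have "v \<in> qcube 0 R"
        using y k by (auto simp: mem_qcube yv inner_add_left abs_mult)
      then obtain z where z: "z \<in> Z" "v \<in> ball z \<delta>" using cov by blast
      then have "v \<in> qcube z \<delta>"
        using cball_subset_qcube[of z \<delta>] ball_subset_cball[of z \<delta>] by blast
      then have "y \<in> qcube (b + k *\<^sub>R z) (k * \<delta>)"
        using k by (auto simp: mem_qcube yv inner_add_left abs_mult simp flip: right_diff_distrib)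
      then show "y \<in> (\<Union>z\<in>Z. qcube (b + k *\<^sub>R z) (k * \<delta>))" using z by blast
    qed
  qed
qed

subsection \<open>Morrey norms\<close>

lemma locally_integrable_measurable:
  fixes w :: "'a::euclidean_space \<Rightarrow> real"
  assumes "locally_integrable w"
  shows "w \<in> borel_measurable lebesgue"
proof (rule borel_measurable_LIMSEQ_real)
  fix n :: nat
  have "set_integrable lebesgue (cball 0 (real n)) w"
    using assms by (simp add: locally_integrable_def)
  then show "(\<lambda>x. indicator (cball 0 (real n)) x *\<^sub>R w x) \<in> borel_measurable lebesgue"
    by (simp add: set_integrable_def borel_measurable_integrable)
next
  fix x :: 'a
  obtain N :: nat where N: "norm x \<le> real N" using real_arch_simple by blast
  have "eventually (\<lambda>n. indicator (cball 0 (real n)) x *\<^sub>R w x = w x) sequentially"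
    using eventually_ge_at_top[of N]
  proof eventually_elim
    case (elim n)
    then have "norm x \<le> real n" using N by (meson of_nat_mono order_trans)
    then show ?case by simp
  qed
  then show "(\<lambda>n. indicator (cball 0 (real n)) x *\<^sub>R w x) \<longlonglongrightarrow> w x"
    by (rule tendsto_eventually)
qed

lemma bounded_locally_integrable:
  assumes f: "f \<in> borel_measurable lebesgue" and b: "\<And>x. \<bar>f x\<bar> \<le> B"
  shows "locally_integrable f"
  unfolding locally_integrable_def set_integrable_def
proof (intro allI impI)
  fix K :: "'a set" assume K: "compact K"
  have K': "K \<in> sets lebesgue" "emeasure lebesgue K < \<infinity>"
    using K emeasure_compact_finite[OF K] borel_compact[OF K] by auto
  show "integrable lebesgue (\<lambda>x. indicator K x *\<^sub>R f x)"
  proof (rule Bochner_Integration.integrable_bound)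
    show "integrable lebesgue (\<lambda>x. indicator K x *\<^sub>R B)"
      using K' by (intro integrable_scaleR_left integrable_real_indicator)
    show "(\<lambda>x. indicator K x *\<^sub>R f x) \<in> borel_measurable lebesgue"
      using f K' by measurable
    show "AE x in lebesgue. norm (indicator K x *\<^sub>R f x) \<le> norm (indicator K x *\<^sub>R B)"
      using b by (intro AE_I2) (auto simp: indicator_def intro: order_trans[OF _ abs_ge_self])
  qed
qed

lemma nn_set_integral_locally_integrable_finite:
  assumes w: "locally_integrable w" "\<And>x. 0 \<le> w x" and Q: "compact Q"
  shows "(\<integral>\<^sup>+x\<in>Q. ennreal (w x) \<partial>lebesgue) \<noteq> top"
proof -
  have "integrable lebesgue (\<lambda>x. indicator Q x *\<^sub>R w x)"
    using w Q by (simp add: locally_integrable_def set_integrable_def)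
  then have "(\<integral>\<^sup>+x. ennreal (norm (indicator Q x *\<^sub>R w x)) \<partial>lebesgue) < \<infinity>"
    by (simp add: integrable_iff_bounded)
  also have "(\<integral>\<^sup>+x. ennreal (norm (indicator Q x *\<^sub>R w x)) \<partial>lebesgue) = (\<integral>\<^sup>+x\<in>Q. ennreal (w x) \<partial>lebesgue)"
    using w(2) by (intro nn_integral_cong) (auto simp: indicator_def)
  finally show ?thesis by simp
qed

lemma avg_SUP_truncation:
  assumes [measurable]: "f \<in> borel_measurable lebesgue" "Q \<in> sets lebesgue"
  shows "avg Q (\<lambda>x. ennreal \<bar>f x\<bar>) = (SUP N::nat. avg Q (\<lambda>x. ennreal \<bar>min \<bar>f x\<bar> (real N)\<bar>))"
proof -
  have inc: "incseq (\<lambda>N x. ennreal \<bar>min \<bar>f x\<bar> (real N)\<bar> * indicator Q x)"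
    by (auto simp: incseq_def le_fun_def indicator_def intro!: ennreal_leI)
  have "(SUP N. ennreal \<bar>min \<bar>f x\<bar> (real N)\<bar> * indicator Q x) = ennreal \<bar>f x\<bar> * indicator Q x" for x
  proof (rule antisym)
    show "(SUP N. ennreal \<bar>min \<bar>f x\<bar> (real N)\<bar> * indicator Q x) \<le> ennreal \<bar>f x\<bar> * indicator Q x"
      by (intro SUP_least mult_right_mono ennreal_leI) auto
    obtain N where "\<bar>f x\<bar> \<le> real N" using real_arch_simple by blast
    then show "ennreal \<bar>f x\<bar> * indicator Q x \<le> (SUP N. ennreal \<bar>min \<bar>f x\<bar> (real N)\<bar> * indicator Q x)"
      by (intro SUP_upper2[of N]) (auto simp: min_def)
  qed
  then have "(\<integral>\<^sup>+x\<in>Q. ennreal \<bar>f x\<bar> \<partial>lebesgue) = (\<integral>\<^sup>+x. (SUP N. ennreal \<bar>min \<bar>f x\<bar> (real N)\<bar> * indicator Q x) \<partial>lebesgue)"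
    by simp
  also have "\<dots> = (SUP N. \<integral>\<^sup>+x. ennreal \<bar>min \<bar>f x\<bar> (real N)\<bar> * indicator Q x \<partial>lebesgue)"
    by (rule nn_integral_monotone_convergence_SUP[OF inc]) measurable
  finally show ?thesis
    by (simp add: avg_def SUP_mult_left_ennreal)
qed

lemma morrey_norm_mono:
  assumes "0 < p" "\<And>x. g x \<le> h x"
  shows "morrey_norm p lam F w g \<le> morrey_norm p lam F w h"
  unfolding morrey_norm_def using assms
  by (intro SUP_subset_mono order_refl enn_powr_mono mult_left_mono nn_integral_mono mult_right_mono) auto

lemma morrey_norm_cmult:
  assumes p: "0 < p" and [measurable]: "w \<in> borel_measurable lebesgue" "g \<in> borel_measurable lebesgue"
    and F: "F \<subseteq> sets lebesgue"
  shows "morrey_norm p lam F w (\<lambda>x. c * g x) = c * morrey_norm p lam F w g"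
  unfolding morrey_norm_def SUP_mult_left_ennreal
proof (rule SUP_cong[OF refl])
  fix P assume "P \<in> F"
  then have [measurable]: "P \<in> sets lebesgue" using F by blast
  have "(\<integral>\<^sup>+x\<in>P. enn_powr (c * g x) p * ennreal (w x) \<partial>lebesgue)
      = (\<integral>\<^sup>+x. enn_powr c p * (enn_powr (g x) p * ennreal (w x) * indicator P x) \<partial>lebesgue)"
    using p by (simp add: enn_powr_mult mult.assoc)
  also have "\<dots> = enn_powr c p * (\<integral>\<^sup>+x\<in>P. enn_powr (g x) p * ennreal (w x) \<partial>lebesgue)"
    by (rule nn_integral_cmult) measurable
  finally show "enn_powr (ennreal (1 / measure lebesgue P powr lam) *
        (\<integral>\<^sup>+x\<in>P. enn_powr (c * g x) p * ennreal (w x) \<partial>lebesgue)) (1 / p)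
      = c * enn_powr (ennreal (1 / measure lebesgue P powr lam) *
        (\<integral>\<^sup>+x\<in>P. enn_powr (g x) p * ennreal (w x) \<partial>lebesgue)) (1 / p)"
    using p by (simp add: enn_powr_mult enn_powr_powr mult_ac)
qed

text \<open>Truncations at height \<open>N\<close> are locally integrable; the left side converges
  monotonically and the right side only grows. The extension is needed since the A_p condition here
  is tested with all measurable functions.\<close>

lemma A_morrey_measurable:
  assumes A: "\<forall>f Q. locally_integrable f \<longrightarrow> Q \<in> cubes \<longrightarrow>
        avg Q (\<lambda>x. ennreal \<bar>f x\<bar>) * morrey_norm p lam F w (indicator Q)
          \<le> ennreal C * morrey_norm p lam F w (\<lambda>x. ennreal \<bar>f x * indicator Q x\<bar>)"
    and p: "0 < p" and f [measurable]: "f \<in> borel_measurable lebesgue" and Q: "Q \<in> cubes"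
  shows "avg Q (\<lambda>x. ennreal \<bar>f x\<bar>) * morrey_norm p lam F w (indicator Q)
          \<le> ennreal C * morrey_norm p lam F w (\<lambda>x. ennreal \<bar>f x * indicator Q x\<bar>)"
proof -
  have [measurable]: "Q \<in> sets lebesgue" using Q by (auto simp: cubes_eq_qcube)
  have "avg Q (\<lambda>x. ennreal \<bar>min \<bar>f x\<bar> (real N)\<bar>) * morrey_norm p lam F w (indicator Q)
      \<le> ennreal C * morrey_norm p lam F w (\<lambda>x. ennreal \<bar>f x * indicator Q x\<bar>)" for N
  proof -
    have "locally_integrable (\<lambda>x. min \<bar>f x\<bar> (real N))"
      by (rule bounded_locally_integrable[where B = "real N"]) auto
    then have "avg Q (\<lambda>x. ennreal \<bar>min \<bar>f x\<bar> (real N)\<bar>) * morrey_norm p lam F w (indicator Q)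
      \<le> ennreal C * morrey_norm p lam F w (\<lambda>x. ennreal \<bar>min \<bar>f x\<bar> (real N) * indicator Q x\<bar>)"
      using A Q by blast
    also have "\<dots> \<le> ennreal C * morrey_norm p lam F w (\<lambda>x. ennreal \<bar>f x * indicator Q x\<bar>)"
      using p by (intro mult_left_mono morrey_norm_mono ennreal_leI) (auto simp: indicator_def)
    finally show ?thesis .
  qed
  then show ?thesis
    by (simp add: avg_SUP_truncation SUP_mult_right_ennreal SUP_least)
qed

text \<open>On \<open>Q\<close> the maximal function of \<open>f\<close> cut off to \<open>Q\<close>
  is at least the average of \<open>f\<close> over \<open>Q\<close>, because \<open>Q\<close>
  competes in the supremum.\<close>

lemma maximal_bounded_imp_A_morrey:
  assumes p: "0 < p" and w: "w \<in> borel_measurable lebesgue" and F: "F \<subseteq> sets lebesgue"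
    and M: "maximal_bounded p lam F w"
  shows "A_morrey p lam F w"
proof -
  obtain C where C: "0 < C" "\<And>f. f \<in> borel_measurable lebesgue \<Longrightarrow>
        morrey_norm p lam F w (maximal (\<lambda>x. ennreal \<bar>f x\<bar>))
          \<le> ennreal C * morrey_norm p lam F w (\<lambda>x. ennreal \<bar>f x\<bar>)"
    using M unfolding maximal_bounded_def by blast
  have "avg Q (\<lambda>x. ennreal \<bar>f x\<bar>) * morrey_norm p lam F w (indicator Q)
          \<le> ennreal C * morrey_norm p lam F w (\<lambda>x. ennreal \<bar>f x * indicator Q x\<bar>)"
    if f: "locally_integrable f" and Q: "Q \<in> cubes" for f Q
  proof -
    have [measurable]: "Q \<in> sets lebesgue" using Q by (auto simp: cubes_eq_qcube)
    have [measurable]: "f \<in> borel_measurable lebesgue" by (rule locally_integrable_measurable[OF f])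
    define m where "m = avg Q (\<lambda>x. ennreal \<bar>f x\<bar>)"
    have "m * morrey_norm p lam F w (indicator Q) = morrey_norm p lam F w (\<lambda>x. m * indicator Q x)"
      by (rule morrey_norm_cmult[OF p w _ F, symmetric]) measurable
    also have "\<dots> \<le> morrey_norm p lam F w (maximal (\<lambda>x. ennreal \<bar>f x * indicator Q x\<bar>))"
    proof (intro morrey_norm_mono p)
      fix x
      show "m * indicator Q x \<le> maximal (\<lambda>x. ennreal \<bar>f x * indicator Q x\<bar>) x"
      proof (cases "x \<in> Q")
        case True
        have "(\<integral>\<^sup>+x\<in>Q. ennreal \<bar>f x\<bar> \<partial>lebesgue) = (\<integral>\<^sup>+x\<in>Q. ennreal \<bar>f x * indicator Q x\<bar> \<partial>lebesgue)"
          by (rule nn_integral_cong) (auto simp: indicator_def)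
        then have "m = avg Q (\<lambda>x. ennreal \<bar>f x * indicator Q x\<bar>)"
          by (simp only: m_def avg_def)
        then show ?thesis
          unfolding maximal_def using True Q by (auto intro!: SUP_upper)
      qed simp
    qed
    also have "\<dots> \<le> ennreal C * morrey_norm p lam F w (\<lambda>x. ennreal \<bar>f x * indicator Q x\<bar>)"
      by (rule C(2)) measurable
    finally show ?thesis by (simp add: m_def)
  qed
  then show ?thesis
    unfolding A_morrey_def using C(1) by blast
qed

subsection \<open>Maximal operator on the Morrey space of a Whitney family\<close>

lemma avg_qcube:
  "0 < l \<Longrightarrow> avg (qcube a l) g = (\<integral>\<^sup>+y\<in>qcube a l. g y \<partial>lebesgue) / emeasure lebesgue (qcube a l)"
  unfolding avg_def
  by (subst emeasure_qcube, simp, subst measure_qcube, simp)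
    (simp add: divide_ennreal_def inverse_ennreal inverse_eq_divide mult.commute)

lemma avg_qcube_le:
  fixes a a' :: "'a::euclidean_space"
  assumes sub: "qcube a l \<subseteq> qcube a' l'" and l: "0 < l" "0 < l'" "l' \<le> m * l"
  shows "avg (qcube a l) g \<le> ennreal (m ^ DIM('a)) * avg (qcube a' l') g"
proof -
  have "(2 * l') ^ DIM('a) \<le> (m * (2 * l)) ^ DIM('a)"
    using l by (intro power_mono) auto
  then have "1 / (2 * l) ^ DIM('a) \<le> m ^ DIM('a) * (1 / (2 * l') ^ DIM('a))"
    using l by (simp add: power_mult_distrib field_simps)
  moreover have "0 < m"
    using l by (meson less_le_trans zero_less_mult_pos2)
  ultimately have "ennreal (1 / measure lebesgue (qcube a l))
      \<le> ennreal (m ^ DIM('a)) * ennreal (1 / measure lebesgue (qcube a' l'))"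
    using l measure_qcube[of l a] measure_qcube[of l' a']
    by (simp add: ennreal_leI flip: ennreal_mult)
  then have "avg (qcube a l) g \<le> (ennreal (m ^ DIM('a)) * ennreal (1 / measure lebesgue (qcube a' l'))) *
      (\<integral>\<^sup>+y\<in>qcube a' l'. g y \<partial>lebesgue)"
    unfolding avg_def using sub
    by (intro mult_mono nn_integral_mono) (auto simp: indicator_def)
  then show ?thesis by (simp only: avg_def mult.assoc)
qed

text \<open>The constant \<open>\<Lambda>\<close> is chosen so that \<open>\<Lambda> * l \<le> infdist a \<Omega>\<close> still gives the \<open>A\<^sub>p\<close> condition on the cube
  dilated by the factor \<open>5 * s\<close> that Vitali covering requires.\<close>
locale whitney = weight w p for w :: "'a::euclidean_space \<Rightarrow> real" and p :: real +
  fixes \<Omega> :: "'a set" and r1 r2 lam s \<Lambda> :: real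
  assumes w_locally_integrable: "locally_integrable w"
    and \<Omega>: "closed \<Omega>" "\<Omega> \<noteq> {}"
    and r: "0 < r1" "r1 < r2" and lam: "0 < lam"
  defines s_def: "s \<equiv> sqrt (real DIM('a))" and \<Lambda>_def: "\<Lambda> \<equiv> 5 * (s * ((2 * r1 + 1) * s))"
begin

abbreviation F :: "'a set set" where
  "F \<equiv> whitney_family \<Omega> r1 r2"

abbreviation X :: "('a \<Rightarrow> ennreal) \<Rightarrow> ennreal" where
  "X \<equiv> morrey_norm p lam F w"

lemma s_ge_1: "1 \<le> s"
  by (simp add: s_def Suc_leI)

lemmas infdist_diff = infdist_diff_le_qcube[where 'a = 'a and \<Omega> = \<Omega>, folded s_def]
  and whitney_exists = whitney_qcube_exists[OF \<Omega> _ r, folded s_def]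
  and whitney_infdist = whitney_qcube_infdist[OF _ _ \<Omega>(2), of _ _ r1 r2, folded s_def]

lemma W_qcube_finite: "emeasure W (qcube a l) \<noteq> top"
proof -
  have "compact (qcube a l)" by (simp add: qcube_def)
  then show ?thesis
    using nn_set_integral_locally_integrable_finite[OF w_locally_integrable w_nonneg] by (simp add: emeasure_W)
qed

lemma set_nn_integral_W:
  assumes "g \<in> borel_measurable lebesgue" "Q \<in> sets lebesgue"
  shows "(\<integral>\<^sup>+x\<in>Q. g x * ennreal (w x) \<partial>lebesgue) = (\<integral>\<^sup>+x\<in>Q. g x \<partial>W)"
  using assms by (subst nn_integral_density) (auto simp: mult_ac)

lemma integral_le_morrey_norm:
  assumes P: "qcube b k \<in> F" and k: "0 < k" and g [measurable]: "g \<in> borel_measurable lebesgue"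
  shows "(\<integral>\<^sup>+x\<in>qcube b k. enn_powr (g x) p \<partial>W)
    \<le> ennreal (measure lebesgue (qcube b k) powr lam) * enn_powr (X g) p"
proof -
  define v where "v = measure lebesgue (qcube b k) powr lam"
  have v: "0 < v" using k measure_qcube[of k b] by (simp add: v_def)
  have "enn_powr (ennreal (1 / v) * (\<integral>\<^sup>+x\<in>qcube b k. enn_powr (g x) p * ennreal (w x) \<partial>lebesgue)) (1 / p) \<le> X g"
    unfolding morrey_norm_def v_def by (rule SUP_upper[OF P])
  then have "ennreal (1 / v) * (\<integral>\<^sup>+x\<in>qcube b k. enn_powr (g x) p \<partial>W) \<le> enn_powr (X g) p"
    using p_gt_1 by (simp add: enn_powr_le_iff set_nn_integral_W)
  then have "ennreal v * (ennreal (1 / v) * (\<integral>\<^sup>+x\<in>qcube b k. enn_powr (g x) p \<partial>W)) \<le> ennreal v * enn_powr (X g) p"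
    by (rule mult_left_mono) simp
  then show ?thesis
    using v unfolding v_def[symmetric] by (simp add: mult.assoc[symmetric] ennreal_mult[symmetric])
qed

text \<open>The hypothesis on \<open>l\<close> places \<open>Q\<close> inside the Whitney cube with
  the same centre. Testing on that cube bounds the norm of the indicator of \<open>Q\<close> from
  below, while every Whitney cube meeting \<open>Q\<close> has at least comparable volume, which
  bounds the norm of the test function from above. The number \<open>\<theta>\<close> is the
  resulting bound for the ratio of half sides.\<close>

lemma local_Ap:
  assumes A: "\<forall>f Q. locally_integrable f \<longrightarrow> Q \<in> cubes \<longrightarrow>
        avg Q (\<lambda>x. ennreal \<bar>f x\<bar>) * X (indicator Q) \<le> ennreal C * X (\<lambda>x. ennreal \<bar>f x * indicator Q x\<bar>)"
    and C: "0 \<le> C" and l: "0 < l" "(2 * r1 + 1) * (s * l) \<le> infdist a \<Omega>"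
  defines "\<theta> \<equiv> (r2 + 1) * (2 * r1 + 1) / (2 * r1\<^sup>2)"
  shows "Ap_on (C powr p * (\<theta> ^ DIM('a)) powr lam) (qcube a l)"
proof -
  define \<kappa> where "\<kappa> = (\<theta> ^ DIM('a)) powr lam"
  have s: "1 \<le> s" by (rule s_ge_1)
  have \<theta>: "0 < \<theta>" using r by (simp add: \<theta>_def)
  have a: "0 < infdist a \<Omega>"
    using l r s by (intro less_le_trans[OF _ l(2)]) auto
  obtain t where t: "0 < t" "qcube a t \<in> F" "infdist a \<Omega> \<le> (2 * r1 + 1) * (s * t)" "2 * r1 * (s * t) \<le> infdist a \<Omega>"
    using whitney_exists[OF a] by blast
  have "(2 * r1 + 1) * (s * l) \<le> (2 * r1 + 1) * (s * t)"
    using l t by linarith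
  then have "l \<le> t" using r s by simp
  then have sub: "qcube a l \<subseteq> qcube a t" by (rule qcube_mono)
  define Q where "Q = qcube a l"
  have Q [measurable]: "Q \<in> sets lebesgue" by (simp add: Q_def)
  define v where "v = measure lebesgue (qcube a t) powr lam"
  have v: "0 < v" using t measure_qcube[of t a] by (simp add: v_def)
  have comp: "1 / (measure lebesgue P powr lam) \<le> \<kappa> / v" if P: "P \<in> F" "y \<in> P" "y \<in> Q" for P y
  proof -
    obtain b k where bk': "P = qcube b k" "0 < k"
      using whitney_familyE[OF P(1)] by blast
    then have bk: "P = qcube b k" "0 < k" "infdist y \<Omega> \<le> 2 * (r2 + 1) * (s * k)"
      using whitney_infdist(2)[of b k y] P by auto
    have "infdist a \<Omega> \<le> infdist y \<Omega> + s * l"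
      using infdist_diff[of y a l] P(3) by (simp add: Q_def)
    \<comment> \<open>After multiplication by \<open>2 * r1 + 1\<close> the term with
      \<open>s * l\<close> is at most \<open>infdist a \<Omega>\<close> and is absorbed, leaving
      \<open>2 * r1\<close> copies of it on the left.\<close>
    then have "(2 * r1 + 1) * infdist a \<Omega> \<le> (2 * r1 + 1) * (2 * (r2 + 1) * (s * k) + s * l)"
      using bk r by (intro mult_left_mono) auto
    also have "\<dots> \<le> (2 * r1 + 1) * (2 * (r2 + 1) * (s * k)) + infdist a \<Omega>"
      using l(2) by (simp add: distrib_left)
    finally have "2 * r1 * infdist a \<Omega> \<le> (2 * r1 + 1) * (2 * (r2 + 1) * (s * k))"
      by (simp add: distrib_right)
    moreover have "2 * r1 * (2 * r1 * (s * t)) \<le> 2 * r1 * infdist a \<Omega>"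
      using t(4) r by (intro mult_left_mono) auto
    ultimately have "2 * r1 * (2 * r1 * (s * t)) \<le> (2 * r1 + 1) * (2 * (r2 + 1) * (s * k))" by linarith
    then have "s * (2 * r1 * (2 * r1 * t)) \<le> s * ((2 * r1 + 1) * (2 * (r2 + 1) * k))"
      by (simp only: mult_ac)
    then have "2 * r1 * (2 * r1 * t) \<le> (2 * r1 + 1) * (2 * (r2 + 1) * k)"
      using s by simp
    then have "t \<le> \<theta> * k"
      using r by (simp add: \<theta>_def field_simps power2_eq_square)
    then have "(2 * t) ^ DIM('a) \<le> (\<theta> * (2 * k)) ^ DIM('a)"
      using t by (intro power_mono) auto
    also have "\<dots> = \<theta> ^ DIM('a) * measure lebesgue P"
      using bk measure_qcube[of k b] by (simp add: power_mult_distrib)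
    finally have "measure lebesgue (qcube a t) \<le> \<theta> ^ DIM('a) * measure lebesgue P"
      using t measure_qcube[of t a] by simp
    then have "v \<le> (\<theta> ^ DIM('a) * measure lebesgue P) powr lam"
      unfolding v_def using lam by (intro powr_mono2) auto
    also have "\<dots> = \<kappa> * measure lebesgue P powr lam"
      using \<theta> by (simp add: powr_mult \<kappa>_def)
    finally have "v \<le> \<kappa> * measure lebesgue P powr lam" .
    moreover have "0 < measure lebesgue P powr lam"
      using bk measure_qcube[of k b] by simp
    ultimately show ?thesis using v by (simp add: field_simps)
  qed
  have \<kappa>: "0 < \<kappa>" using \<theta> by (simp add: \<kappa>_def)
  have "enn_powr (avg Q (\<lambda>x. ennreal \<bar>f x\<bar>)) p * emeasure W Q
       \<le> ennreal (C powr p * \<kappa>) * (\<integral>\<^sup>+x\<in>Q. enn_powr (ennreal \<bar>f x\<bar>) p \<partial>W)"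
    if f [measurable]: "f \<in> borel_measurable lebesgue" for f
  proof -
    define I where "I = (\<integral>\<^sup>+x\<in>Q. enn_powr (ennreal \<bar>f x\<bar>) p \<partial>W)"
    have 1: "emeasure W Q \<le> ennreal v * enn_powr (X (indicator Q)) p"
    proof -
      have "emeasure W Q = (\<integral>\<^sup>+x. indicator Q x \<partial>W)" by simp
      also have "\<dots> = (\<integral>\<^sup>+x\<in>qcube a t. enn_powr (indicator Q x) p \<partial>W)"
        using sub by (intro nn_integral_cong) (auto simp: indicator_def Q_def)
      also have "\<dots> \<le> ennreal v * enn_powr (X (indicator Q)) p"
        unfolding v_def by (rule integral_le_morrey_norm[OF t(2,1)]) measurable
      finally show ?thesis .
    qed
    \<comment> \<open>Only members of \<open>F\<close> that meet \<open>Q\<close> contribute, and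
      \<open>comp\<close> bounds the volume factor of each by \<open>\<kappa> / v\<close>; the
      \<open>v\<close> cancels against the one in \<open>1\<close>.\<close>
    have 2: "enn_powr (X (\<lambda>x. ennreal \<bar>f x * indicator Q x\<bar>)) p \<le> ennreal (\<kappa> / v) * I"
      unfolding enn_powr_le_iff[OF less_trans[OF zero_less_one p_gt_1]] morrey_norm_def
    proof (intro SUP_least enn_powr_mono)
      fix P assume P: "P \<in> F"
      have [measurable]: "P \<in> sets lebesgue"
        using P by (auto simp: whitney_family_def cubes_eq_qcube)
      show "ennreal (1 / measure lebesgue P powr lam) *
          (\<integral>\<^sup>+x\<in>P. enn_powr (ennreal \<bar>f x * indicator Q x\<bar>) p * ennreal (w x) \<partial>lebesgue) \<le> ennreal (\<kappa> / v) * I"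
      proof (cases "P \<inter> Q = {}")
        case True
        then have "(\<integral>\<^sup>+x\<in>P. enn_powr (ennreal \<bar>f x * indicator Q x\<bar>) p * ennreal (w x) \<partial>lebesgue) = (\<integral>\<^sup>+x. 0 \<partial>(lebesgue :: 'a measure))"
          by (intro nn_integral_cong) (auto simp: indicator_def)
        then show ?thesis by simp
      next
        case False
        then obtain y where y: "y \<in> P" "y \<in> Q" by blast
        have "(\<integral>\<^sup>+x\<in>P. enn_powr (ennreal \<bar>f x * indicator Q x\<bar>) p * ennreal (w x) \<partial>lebesgue)
            \<le> (\<integral>\<^sup>+x\<in>Q. enn_powr (ennreal \<bar>f x\<bar>) p * ennreal (w x) \<partial>lebesgue)"
          by (intro nn_integral_mono) (auto simp: indicator_def)
        also have "\<dots> = I"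
          unfolding I_def by (rule set_nn_integral_W) measurable
        finally show ?thesis
          using comp[OF P y] by (intro mult_mono ennreal_leI) auto
      qed
    qed (use p_gt_1 in auto)
    have "enn_powr (avg Q (\<lambda>x. ennreal \<bar>f x\<bar>)) p * emeasure W Q
        \<le> enn_powr (avg Q (\<lambda>x. ennreal \<bar>f x\<bar>)) p * (ennreal v * enn_powr (X (indicator Q)) p)"
      by (intro mult_left_mono 1) simp
    also have "\<dots> = ennreal v * enn_powr (avg Q (\<lambda>x. ennreal \<bar>f x\<bar>) * X (indicator Q)) p"
      using p_gt_1 by (simp add: enn_powr_mult mult_ac)
    also have "\<dots> \<le> ennreal v * enn_powr (ennreal C * X (\<lambda>x. ennreal \<bar>f x * indicator Q x\<bar>)) p"
      using p_gt_1 l by (intro mult_left_mono enn_powr_mono A_morrey_measurable[OF A]) (auto simp: Q_def qcube_in_cubes)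
    also have "\<dots> = ennreal v * (ennreal (C powr p) * enn_powr (X (\<lambda>x. ennreal \<bar>f x * indicator Q x\<bar>)) p)"
      using p_gt_1 C by (simp add: enn_powr_mult enn_powr_ennreal)
    also have "\<dots> \<le> ennreal v * (ennreal (C powr p) * (ennreal (\<kappa> / v) * I))"
      by (intro mult_left_mono 2) auto
    also have "\<dots> = (ennreal v * ennreal (C powr p) * ennreal (\<kappa> / v)) * I"
      by (simp only: mult_ac)
    also have "ennreal v * ennreal (C powr p) * ennreal (\<kappa> / v) = ennreal (C powr p * \<kappa>)"
      using v \<kappa> by (simp flip: ennreal_mult)
    finally show ?thesis by (simp add: I_def)
  qed
  then show ?thesis by (simp add: Ap_on_def Q_def \<kappa>_def)
qed

text \<open>The neighbourhood of a Whitney cube to which \<open>f\<close> is cut off. It is wide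
  enough to contain every small cube meeting \<open>qcube b k\<close>. The lower bound on the
  distance, half of the one valid on \<open>qcube b k\<close>, keeps it away from
  \<open>\<Omega>\<close>, so that each of its points is the centre of a Whitney cube of comparable
  size.\<close>

definition star :: "'a \<Rightarrow> real \<Rightarrow> 'a set" where
  "star b k = {y\<in>qcube b (k * (r2 + 2)). r1 * (s * k) \<le> infdist y \<Omega>}"

lemma star_sets [measurable]: "star b k \<in> sets lebesgue"
proof -
  have "star b k = qcube b (k * (r2 + 2)) \<inter> {y. r1 * (s * k) \<le> infdist y \<Omega>}"
    by (auto simp: star_def)
  moreover have "closed {y. r1 * (s * k) \<le> infdist y \<Omega>}"
    by (intro closed_Collect_le continuous_intros)
  ultimately show ?thesis by auto
qed

text \<open>Cover \<open>star b k\<close> by a bounded number of pieces, each so small that it fits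
  into the Whitney cube centred at any one of its points, and apply the definition of the Morrey
  norm to these cubes.\<close>

lemma integral_star_le:
  obtains N where "0 \<le> N" and "\<And>b k (g :: 'a \<Rightarrow> ennreal). qcube b k \<in> F \<Longrightarrow> 0 < k \<Longrightarrow> g \<in> borel_measurable lebesgue \<Longrightarrow>
    (\<integral>\<^sup>+x\<in>star b k. enn_powr (g x) p \<partial>W)
      \<le> ennreal (N * measure lebesgue (qcube b k) powr lam) * enn_powr (X g) p"
proof -
  \<comment> \<open>A Whitney cube centred at a point of \<open>star b k\<close> has half side at
    least \<open>r1 * k / (2 * r1 + 1) = 2 * (k * \<delta>)\<close>, and a piece of half side
    \<open>k * \<delta>\<close> lies within \<open>2 * (k * \<delta>)\<close> of each of its points
    in every coordinate.\<close>
  define \<delta> where "\<delta> = r1 / (2 * (2 * r1 + 1))"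
  have \<delta>: "0 < \<delta>" using r by (simp add: \<delta>_def)
  \<comment> \<open>Bounds the half side of those Whitney cubes by \<open>\<tau> * k\<close>: the
    numerator adds \<open>2 * (r2 + 1)\<close>, from the distance of \<open>b\<close>, to
    \<open>r2 + 2\<close>, from the width of \<open>star b k\<close>.\<close>
  define \<tau> where "\<tau> = (3 * r2 + 4) / (2 * r1)"
  have \<tau>: "0 < \<tau>" using r by (simp add: \<tau>_def)
  obtain Z :: "'a set" where Z: "finite Z"
    "\<And>b k. 0 < k \<Longrightarrow> qcube b (k * (r2 + 2)) \<subseteq> (\<Union>z\<in>Z. qcube (b + k *\<^sub>R z) (k * \<delta>))"
    using qcube_finite_cover[OF \<delta>, of "r2 + 2"] by blast
  define N where "N = real (card Z) * (\<tau> ^ DIM('a)) powr lam"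
  show ?thesis
  proof (rule that)
    show "0 \<le> N" by (simp add: N_def)
    fix b k and g :: "'a \<Rightarrow> ennreal"
    assume P: "qcube b k \<in> F" and k: "0 < k" and g [measurable]: "g \<in> borel_measurable lebesgue"
    define v where "v = (\<tau> ^ DIM('a)) powr lam * measure lebesgue (qcube b k) powr lam"
    define T where "T z = qcube (b + k *\<^sub>R z) (k * \<delta>) \<inter> star b k" for z
    have [measurable]: "T z \<in> sets lebesgue" for z by (simp add: T_def)
    have b_le: "infdist b \<Omega> \<le> 2 * (r2 + 1) * (s * k)"
      using whitney_infdist(2)[OF P k, of b] k by simp
    have each: "(\<integral>\<^sup>+x\<in>T z. enn_powr (g x) p \<partial>W) \<le> ennreal v * enn_powr (X g) p" for z
    proof (cases "T z = {}")
      case True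
      then show ?thesis by simp
    next
      case False
      then obtain y where y: "y \<in> qcube (b + k *\<^sub>R z) (k * \<delta>)" "y \<in> star b k" by (auto simp: T_def)
      have y_ge: "r1 * (s * k) \<le> infdist y \<Omega>" and y_in: "y \<in> qcube b (k * (r2 + 2))"
        using y(2) by (auto simp: star_def)
      have y0: "0 < infdist y \<Omega>"
        using r k s_ge_1 by (intro less_le_trans[OF _ y_ge]) auto
      obtain t where t: "0 < t" "qcube y t \<in> F" "infdist y \<Omega> \<le> (2 * r1 + 1) * (s * t)" "2 * r1 * (s * t) \<le> infdist y \<Omega>"
        using whitney_exists[OF y0] by blast
      have "2 * ((2 * r1 + 1) * \<delta>) = r1"
        using r by (simp add: \<delta>_def field_simps)
      moreover have "(2 * r1 + 1) * (s * (2 * (k * \<delta>))) = (2 * ((2 * r1 + 1) * \<delta>)) * (s * k)"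
        by (simp only: mult_ac)
      ultimately have "(2 * r1 + 1) * (s * (2 * (k * \<delta>))) = r1 * (s * k)" by simp
      then have "(2 * r1 + 1) * (s * (2 * (k * \<delta>))) \<le> (2 * r1 + 1) * (s * t)"
        using y_ge t by linarith
      then have "2 * (k * \<delta>) \<le> t" using r s_ge_1 by simp
      then have sub: "T z \<subseteq> qcube y t"
        using qcube_meet_subset[OF _ y(1), of y 0] qcube_mono[of "2 * (k * \<delta>)" t y] by (auto simp: T_def)
      have "2 * r1 * (s * t) \<le> 2 * (r2 + 1) * (s * k) + s * (k * (r2 + 2))"
        using t(4) infdist_diff[OF y_in] b_le by linarith
      then have "s * (2 * r1 * t) \<le> s * ((3 * r2 + 4) * k)"
        by (simp add: algebra_simps)
      then have "2 * r1 * t \<le> (3 * r2 + 4) * k" using s_ge_1 by simp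
      then have "t \<le> \<tau> * k" using r by (simp add: \<tau>_def field_simps)
      then have "(2 * t) ^ DIM('a) \<le> (\<tau> * (2 * k)) ^ DIM('a)"
        using t by (intro power_mono) auto
      then have "measure lebesgue (qcube y t) \<le> \<tau> ^ DIM('a) * measure lebesgue (qcube b k)"
        using t k measure_qcube[of t y] measure_qcube[of k b] by (simp add: power_mult_distrib)
      then have "measure lebesgue (qcube y t) powr lam \<le> (\<tau> ^ DIM('a) * measure lebesgue (qcube b k)) powr lam"
        using lam by (intro powr_mono2) auto
      also have "\<dots> = v" using \<tau> by (simp add: powr_mult v_def)
      finally have vol: "measure lebesgue (qcube y t) powr lam \<le> v" .
      have "(\<integral>\<^sup>+x\<in>T z. enn_powr (g x) p \<partial>W) \<le> (\<integral>\<^sup>+x\<in>qcube y t. enn_powr (g x) p \<partial>W)"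
        using sub by (intro nn_integral_mono) (auto simp: indicator_def)
      also have "\<dots> \<le> ennreal (measure lebesgue (qcube y t) powr lam) * enn_powr (X g) p"
        by (rule integral_le_morrey_norm[OF t(2,1) g])
      also have "\<dots> \<le> ennreal v * enn_powr (X g) p"
        using vol by (intro mult_right_mono ennreal_leI) auto
      finally show ?thesis .
    qed
    have "(\<integral>\<^sup>+x\<in>star b k. enn_powr (g x) p \<partial>W) \<le> (\<integral>\<^sup>+x. (\<Sum>z\<in>Z. enn_powr (g x) p * indicator (T z) x) \<partial>W)"
    proof (rule nn_integral_mono)
      fix x
      show "enn_powr (g x) p * indicator (star b k) x \<le> (\<Sum>z\<in>Z. enn_powr (g x) p * indicator (T z) x)"
      proof (cases "x \<in> star b k")
        case True
        then obtain z where z: "z \<in> Z" "x \<in> T z"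
          using Z(2)[OF k, of b] by (auto simp: star_def T_def)
        then have "enn_powr (g x) p * indicator (T z) x \<le> (\<Sum>z\<in>Z. enn_powr (g x) p * indicator (T z) x)"
          using Z(1) by (intro member_le_sum) auto
        then show ?thesis using z True by simp
      qed simp
    qed
    also have "\<dots> = (\<Sum>z\<in>Z. \<integral>\<^sup>+x\<in>T z. enn_powr (g x) p \<partial>W)"
      by (rule nn_integral_sum) measurable
    also have "\<dots> \<le> (\<Sum>z\<in>Z. ennreal v * enn_powr (X g) p)"
      by (intro sum_mono each)
    also have "\<dots> = ennreal (N * measure lebesgue (qcube b k) powr lam) * enn_powr (X g) p"
      by (simp add: N_def v_def ennreal_mult ennreal_of_nat_eq_real_of_nat mult.assoc)
    finally show "(\<integral>\<^sup>+x\<in>star b k. enn_powr (g x) p \<partial>W)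
      \<le> ennreal (N * measure lebesgue (qcube b k) powr lam) * enn_powr (X g) p" .
  qed
qed

section \<open>Small and large cubes meeting a Whitney cube\<close>

lemma \<Lambda>_ge: "5 * s \<le> \<Lambda>" "5 \<le> \<Lambda>"
proof -
  have "1 * 1 \<le> (2 * r1 + 1) * s"
    using r s_ge_1 by (intro mult_mono) auto
  then have "s * 1 \<le> s * ((2 * r1 + 1) * s)"
    using s_ge_1 by (intro mult_left_mono) auto
  then show "5 * s \<le> \<Lambda>" by (simp add: \<Lambda>_def)
  then show "5 \<le> \<Lambda>" using s_ge_1 by simp
qed

text \<open>A countable substitute for the family of all cubes that meet \<open>P\<close> and are small compared with
  their distance to \<open>\<Omega>\<close>.\<close>
definition small_cubes :: "'a set \<Rightarrow> 'a set \<Rightarrow> ('a \<times> real) set" where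
  "small_cubes D P = {(a, l). a \<in> D \<and> l \<in> \<rat> \<and> 0 < l \<and> \<Lambda> * l \<le> infdist a \<Omega> \<and> qcube a l \<inter> P \<noteq> {}}"

lemma countable_small_cubes: "countable D \<Longrightarrow> countable (small_cubes D P)"
  by (rule countable_subset[of _ "D \<times> \<rat>"]) (auto simp: small_cubes_def countable_rat)

text \<open>Since \<open>5 * (s * l) \<le> infdist a \<Omega>\<close>, the distance to
  \<open>\<Omega>\<close> varies little over the small cube, and at a common point it is comparable
  to \<open>s * k\<close>. The bound on \<open>l\<close> is also the uniform radius bound for
  Vitali.\<close>

lemma small_cubesD:
  assumes P: "qcube b k \<in> F" and k: "0 < k" and al: "(a, l) \<in> small_cubes D (qcube b k)"
  shows "l \<le> k * (r2 + 1) / 2" and "qcube a l \<subseteq> star b k"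
proof -
  have l: "0 < l" "\<Lambda> * l \<le> infdist a \<Omega>" and ne: "qcube a l \<inter> qcube b k \<noteq> {}"
    using al by (auto simp: small_cubes_def)
  obtain z where z: "z \<in> qcube a l" "z \<in> qcube b k" using ne by blast
  have "5 * s * l \<le> \<Lambda> * l" using \<Lambda>_ge l by (intro mult_right_mono) auto
  then have sl: "5 * (s * l) \<le> infdist a \<Omega>" using l(2) by linarith
  have dz: "infdist a \<Omega> \<le> infdist z \<Omega> + s * l" "infdist z \<Omega> \<le> infdist a \<Omega> + s * l"
    using infdist_diff[OF z(1)] by auto
  note zb = whitney_infdist[OF P k z(2)]
  have "4 * (s * l) \<le> 2 * (r2 + 1) * (s * k)" using sl dz(1) zb(2) by linarith
  then have "s * (4 * l) \<le> s * (2 * (r2 + 1) * k)" by (simp only: mult_ac)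
  then have "4 * l \<le> 2 * (r2 + 1) * k" using s_ge_1 by simp
  then show lk: "l \<le> k * (r2 + 1) / 2" by (simp add: field_simps)
  show "qcube a l \<subseteq> star b k"
  proof
    fix y assume y: "y \<in> qcube a l"
    have "k + 2 * l \<le> k * (r2 + 2)" using lk by (simp add: field_simps)
    then have "y \<in> qcube b (k * (r2 + 2))"
      using qcube_meet_subset[OF z(2,1)] qcube_mono[of "k + 2 * l" "k * (r2 + 2)" b] y by blast
    \<comment> \<open>With \<open>d = infdist a \<Omega>\<close> the facts give
      \<open>6/5 * d \<ge> 2 * r1 * (s * k)\<close> and
      \<open>infdist y \<Omega> \<ge> 4/5 * d\<close>, which exceeds what is needed by a factor
      \<open>4/3\<close>.\<close>
    moreover have "r1 * (s * k) \<le> infdist y \<Omega>"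
    proof -
      have "infdist a \<Omega> \<le> infdist y \<Omega> + s * l" using infdist_diff[OF y] by auto
      moreover have "0 \<le> r1 * (s * k)" using r s_ge_1 k by simp
      ultimately show ?thesis using sl dz(2) zb(1) by linarith
    qed
    ultimately show "y \<in> star b k" by (simp add: star_def)
  qed
qed

text \<open>Move the centre to a nearby point of the dense set and enlarge the half side to a
  rational below \<open>2 * l\<close>. In the threshold, \<open>2 * \<Lambda>\<close> pays for the
  enlargement and 1 for the displaced centre.\<close>

lemma small_cube_cover:
  assumes D: "\<And>S. open S \<Longrightarrow> S \<noteq> {} \<Longrightarrow> \<exists>d\<in>D. d \<in> S" and l: "0 < l" "(2 * \<Lambda> + 1) * l \<le> infdist a \<Omega>"
    and x: "x \<in> qcube a l" "x \<in> P"
  obtains a' l' where "(a', l') \<in> small_cubes D P" "qcube a l \<subseteq> qcube a' l'" "l' \<le> 2 * l" "0 < l'"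
proof -
  obtain a' where a': "a' \<in> D" "dist a a' < l / 4"
    using D[of "ball a (l / 4)"] l by auto
  obtain l' where l': "l' \<in> \<rat>" "5 * l / 4 < l'" "l' < 2 * l"
    using Rats_dense_in_real[of "5 * l / 4" "2 * l"] l by auto
  have sub: "qcube a l \<subseteq> qcube a' l'"
    using a' l' by (intro qcube_subset_qcube) auto
  have "\<Lambda> * l' \<le> \<Lambda> * (2 * l)"
    using \<Lambda>_ge l' by (intro mult_left_mono) auto
  also have "\<dots> \<le> infdist a \<Omega> - l" using l by (simp add: algebra_simps)
  also have "\<dots> \<le> infdist a' \<Omega>"
    using infdist_triangle_abs[of a \<Omega> a'] a' l by linarith
  finally have "(a', l') \<in> small_cubes D P"
    using a' l' l x sub by (auto simp: small_cubes_def)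
  then show ?thesis using that sub l' l by auto
qed

text \<open>Such a cube may even meet \<open>\<Omega>\<close>, so A_p is not at hand. Its dilate by
  \<open>m\<close> contains the whole Whitney cube, whose \<open>W\<close> measure is thereby
  controlled by the norm of the indicator of the dilate, and \<open>A_morrey\<close> bounds the
  product of that norm with the average. The number \<open>m\<close> comes from \<open>2 * r1 * (s *
  k) \<le> infdist a \<Omega> + s * l \<le> (L + s) * l\<close>.\<close>

lemma avg_large_cube_le:
  assumes A: "\<forall>f Q. locally_integrable f \<longrightarrow> Q \<in> cubes \<longrightarrow>
        avg Q (\<lambda>x. ennreal \<bar>f x\<bar>) * X (indicator Q) \<le> ennreal C * X (\<lambda>x. ennreal \<bar>f x * indicator Q x\<bar>)"
    and C: "0 \<le> C"
    and P: "qcube b k \<in> F" and k: "0 < k" and x: "x \<in> qcube a l" "x \<in> qcube b k"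
    and l: "0 < l" "infdist a \<Omega> \<le> L * l" and L: "0 \<le> L"
    and f [measurable]: "f \<in> borel_measurable lebesgue"
  defines "m \<equiv> 1 + (L + s) / (r1 * s)"
  shows "enn_powr (avg (qcube a l) (\<lambda>x. ennreal \<bar>f x\<bar>)) p * emeasure W (qcube b k)
    \<le> ennreal ((m ^ DIM('a) * C) powr p * measure lebesgue (qcube b k) powr lam) * enn_powr (X (\<lambda>x. ennreal \<bar>f x\<bar>)) p"
proof -
  have m1: "1 \<le> m" using L r s_ge_1 by (simp add: m_def)
  define l' where "l' = m * l"
  have l'0: "0 < l'" using m1 l by (simp add: l'_def)
  have "2 * r1 * (s * k) \<le> infdist a \<Omega> + s * l"
    using whitney_infdist(1)[OF P k x(2)] infdist_diff[OF x(1)] by linarith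
  also have "\<dots> \<le> (L + s) * l" using l by (simp add: distrib_right)
  finally have "2 * k * (r1 * s) \<le> (L + s) * l" by (simp add: mult_ac)
  moreover have "0 < r1 * s" using r s_ge_1 by simp
  ultimately have "2 * k \<le> (L + s) / (r1 * s) * l"
    by (simp add: pos_le_divide_eq)
  then have lk: "l + 2 * k \<le> l'" by (simp add: l'_def m_def distrib_right)
  define Q where "Q = qcube a l'"
  have [measurable]: "Q \<in> sets lebesgue" by (simp add: Q_def)
  have PQ: "qcube b k \<subseteq> Q"
    using qcube_meet_subset[OF x] qcube_mono[OF lk, of a] by (auto simp: Q_def)
  have "qcube a l \<subseteq> qcube a l'"
    using k lk by (intro qcube_mono) auto
  then have avg: "avg (qcube a l) (\<lambda>x. ennreal \<bar>f x\<bar>) \<le> ennreal (m ^ DIM('a)) * avg Q (\<lambda>x. ennreal \<bar>f x\<bar>)"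
    unfolding Q_def using l l'0 by (intro avg_qcube_le) (auto simp: l'_def)
  define v where "v = measure lebesgue (qcube b k) powr lam"
  have "emeasure W (qcube b k) = (\<integral>\<^sup>+x\<in>qcube b k. enn_powr (indicator Q x) p \<partial>W)"
  proof -
    have "emeasure W (qcube b k) = (\<integral>\<^sup>+x. indicator (qcube b k) x \<partial>W)" by simp
    also have "\<dots> = (\<integral>\<^sup>+x\<in>qcube b k. enn_powr (indicator Q x) p \<partial>W)"
      using PQ by (intro nn_integral_cong) (auto simp: indicator_def)
    finally show ?thesis .
  qed
  also have "\<dots> \<le> ennreal v * enn_powr (X (indicator Q)) p"
    unfolding v_def by (rule integral_le_morrey_norm[OF P k]) measurable
  finally have W: "emeasure W (qcube b k) \<le> ennreal v * enn_powr (X (indicator Q)) p" .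
  have "avg Q (\<lambda>x. ennreal \<bar>f x\<bar>) * X (indicator Q) \<le> ennreal C * X (\<lambda>x. ennreal \<bar>f x * indicator Q x\<bar>)"
    using l'0 p_gt_1 by (intro A_morrey_measurable[OF A]) (auto simp: Q_def qcube_in_cubes)
  also have "\<dots> \<le> ennreal C * X (\<lambda>x. ennreal \<bar>f x\<bar>)"
    using p_gt_1 by (intro mult_left_mono morrey_norm_mono ennreal_leI) (auto simp: indicator_def)
  finally have test: "avg Q (\<lambda>x. ennreal \<bar>f x\<bar>) * X (indicator Q) \<le> ennreal C * X (\<lambda>x. ennreal \<bar>f x\<bar>)" .
  have "enn_powr (avg (qcube a l) (\<lambda>x. ennreal \<bar>f x\<bar>)) p * emeasure W (qcube b k)
    \<le> enn_powr (ennreal (m ^ DIM('a)) * avg Q (\<lambda>x. ennreal \<bar>f x\<bar>)) p * (ennreal v * enn_powr (X (indicator Q)) p)"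
    using p_gt_1 by (intro mult_mono enn_powr_mono avg W) auto
  also have "\<dots> = ennreal v * enn_powr (ennreal (m ^ DIM('a)) * (avg Q (\<lambda>x. ennreal \<bar>f x\<bar>) * X (indicator Q))) p"
    using p_gt_1 by (simp add: enn_powr_mult mult_ac)
  also have "\<dots> \<le> ennreal v * enn_powr (ennreal (m ^ DIM('a)) * (ennreal C * X (\<lambda>x. ennreal \<bar>f x\<bar>))) p"
    using p_gt_1 by (intro mult_left_mono enn_powr_mono test) auto
  also have "\<dots> = ennreal v * (ennreal ((m ^ DIM('a)) powr p) * (ennreal (C powr p) * enn_powr (X (\<lambda>x. ennreal \<bar>f x\<bar>)) p))"
    using p_gt_1 m1 C by (simp add: enn_powr_mult enn_powr_ennreal)
  also have "\<dots> = (ennreal ((m ^ DIM('a)) powr p) * ennreal (C powr p) * ennreal v) * enn_powr (X (\<lambda>x. ennreal \<bar>f x\<bar>)) p"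
    by (simp only: mult_ac)
  also have "ennreal ((m ^ DIM('a)) powr p) * ennreal (C powr p) * ennreal v = ennreal ((m ^ DIM('a) * C) powr p * v)"
    using m1 C by (simp add: powr_mult v_def flip: ennreal_mult)
  finally show ?thesis by (simp add: v_def)
qed

theorem A_morrey_imp_maximal_bounded:
  assumes "A_morrey p lam F w"
  shows "maximal_bounded p lam F w"
proof -
  obtain C where C: "0 < C" and A: "\<forall>f Q. locally_integrable f \<longrightarrow> Q \<in> cubes \<longrightarrow>
        avg Q (\<lambda>x. ennreal \<bar>f x\<bar>) * X (indicator Q) \<le> ennreal C * X (\<lambda>x. ennreal \<bar>f x * indicator Q x\<bar>)"
    using assms unfolding A_morrey_def by blast
  define \<theta> where "\<theta> = (r2 + 1) * (2 * r1 + 1) / (2 * r1\<^sup>2)"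
  define c where "c = C powr p * (\<theta> ^ DIM('a)) powr lam"
  have c: "0 \<le> c" by (simp add: c_def)
  obtain Cm where Cm: "0 \<le> Cm" and muck: "\<And>(J :: ('a \<times> real) set) B (f :: 'a \<Rightarrow> real). countable J \<Longrightarrow>
    (\<And>a l. (a, l) \<in> J \<Longrightarrow> 0 < l \<and> l \<le> B \<and> Ap_on c (qcube a l) \<and>
      Ap_on c (qcube a (5 * (s * l))) \<and> emeasure W (qcube a (5 * (s * l))) \<noteq> top) \<Longrightarrow>
    f \<in> borel_measurable lebesgue \<Longrightarrow> (\<And>x. 0 \<le> f x) \<Longrightarrow>
    (\<integral>\<^sup>+x. enn_powr (wmax lebesgue J (\<lambda>x. ennreal (f x)) x) p \<partial>W)
      \<le> ennreal Cm * (\<integral>\<^sup>+x. enn_powr (ennreal (f x)) p \<partial>W)"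
    using muckenhoupt[OF c, folded s_def] by blast
  obtain N where N: "0 \<le> N" and star: "\<And>b k (g :: 'a \<Rightarrow> ennreal). qcube b k \<in> F \<Longrightarrow> 0 < k \<Longrightarrow> g \<in> borel_measurable lebesgue \<Longrightarrow>
    (\<integral>\<^sup>+x\<in>star b k. enn_powr (g x) p \<partial>W)
      \<le> ennreal (N * measure lebesgue (qcube b k) powr lam) * enn_powr (X g) p"
    using integral_star_le by blast
  obtain D :: "'a set" where D: "countable D" "\<And>S. open S \<Longrightarrow> S \<noteq> {} \<Longrightarrow> \<exists>d\<in>D. d \<in> S"
    using countable_dense_exists by blast
  \<comment> \<open>The threshold of \<open>small_cube_cover\<close>: a cube either lies in a small
    cube of at most twice its half side or satisfies
    \<open>infdist a \<Omega> \<le> L * l\<close>.\<close>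
  define L where "L = 2 * \<Lambda> + 1"
  have L: "0 \<le> L" using \<Lambda>_ge by (simp add: L_def)
  define m where "m = 1 + (L + s) / (r1 * s)"
  have m: "0 < m" using L r s_ge_1 by (simp add: m_def add_pos_nonneg)
  define K where "K = (2 ^ DIM('a)) powr p * (Cm * N) + (m ^ DIM('a) * C) powr p"
  have K: "0 < K" using Cm N m C by (simp add: K_def add_nonneg_pos)
  have main: "(\<integral>\<^sup>+x\<in>P. enn_powr (maximal (\<lambda>x. ennreal \<bar>f x\<bar>) x) p * ennreal (w x) \<partial>lebesgue)
      \<le> ennreal (K * measure lebesgue P powr lam) * enn_powr (X (\<lambda>x. ennreal \<bar>f x\<bar>)) p"
    if f [measurable]: "f \<in> borel_measurable lebesgue" and PF: "P \<in> F" for f P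
  proof -
    obtain b k where Pbk: "P = qcube b k" and k: "0 < k" using PF by (rule whitney_familyE)
    have P: "qcube b k \<in> F" using PF Pbk by simp
    have [measurable]: "P \<in> sets lebesgue" by (simp add: Pbk)
    define v where "v = measure lebesgue P powr lam"
    have v: "0 \<le> v" by (simp add: v_def)
    define Xf where "Xf = enn_powr (X (\<lambda>x. ennreal \<bar>f x\<bar>)) p"
    define J where "J = small_cubes D P"
    have J: "countable J" unfolding J_def by (rule countable_small_cubes[OF D(1)])
    \<comment> \<open>All cubes in \<open>J\<close> lie in \<open>star b k\<close>, so the cut-off
      leaves their averages unchanged while making the global \<open>L\<^sup>p\<close> norm
      accessible through the Morrey norm.\<close>
    define g where "g x = \<bar>f x\<bar> * indicator (star b k) x" for x
    have [measurable]: "g \<in> borel_measurable lebesgue"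
      unfolding g_def[abs_def] by measurable
    define M where "M = wmax lebesgue J (\<lambda>x. ennreal (g x))"
    have [measurable]: "M \<in> borel_measurable lebesgue"
      unfolding M_def by (rule borel_measurable_wmax[OF J refl])
    define Lg where "Lg = {(a, l). 0 < l \<and> infdist a \<Omega> \<le> L * l \<and> qcube a l \<inter> P \<noteq> {}}"
    \<comment> \<open>A number independent of the point of \<open>P\<close>:
      \<open>avg_large_cube_le\<close> bounds each average against the full \<open>W\<close> measure
      of \<open>P\<close>.\<close>
    define S where "S = (SUP (a, l)\<in>Lg. avg (qcube a l) (\<lambda>x. ennreal \<bar>f x\<bar>))"
    have split: "maximal (\<lambda>x. ennreal \<bar>f x\<bar>) x \<le> max (ennreal (2 ^ DIM('a)) * M x) S" if x: "x \<in> P" for x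
      unfolding maximal_def
    proof (rule SUP_least, clarify)
      fix Q :: "'a set" assume "Q \<in> cubes" and xQ: "x \<in> Q"
      then obtain a l where Q: "Q = qcube a l" "0 < l" by (auto simp: cubes_eq_qcube)
      show "avg Q (\<lambda>x. ennreal \<bar>f x\<bar>) \<le> max (ennreal (2 ^ DIM('a)) * M x) S"
      proof (cases "infdist a \<Omega> \<le> L * l")
        case True
        then have "(a, l) \<in> Lg" using Q xQ x by (auto simp: Lg_def)
        then have "avg Q (\<lambda>x. ennreal \<bar>f x\<bar>) \<le> S"
          unfolding S_def Q by (intro SUP_upper2[of "(a, l)"]) auto
        then show ?thesis by (simp add: le_max_iff_disj)
      next
        case False
        then have big: "(2 * \<Lambda> + 1) * l \<le> infdist a \<Omega>" by (simp add: L_def)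
        have "x \<in> qcube a l" using xQ Q(1) by simp
        from small_cube_cover[OF D(2) Q(2) big this x]
        obtain a' l' where al': "(a', l') \<in> J" "qcube a l \<subseteq> qcube a' l'" "l' \<le> 2 * l" "0 < l'"
          unfolding J_def by blast
        have "avg Q (\<lambda>x. ennreal \<bar>f x\<bar>) \<le> ennreal (2 ^ DIM('a)) * avg (qcube a' l') (\<lambda>x. ennreal \<bar>f x\<bar>)"
          unfolding Q(1) by (rule avg_qcube_le[OF al'(2) Q(2) al'(4,3)])
        also have "avg (qcube a' l') (\<lambda>x. ennreal \<bar>f x\<bar>) \<le> M x"
        proof -
          have "qcube a' l' \<subseteq> star b k"
            using small_cubesD(2)[OF P k] al'(1) by (simp add: J_def Pbk)
          then have "(\<integral>\<^sup>+y\<in>qcube a' l'. ennreal \<bar>f y\<bar> \<partial>lebesgue) = (\<integral>\<^sup>+y\<in>qcube a' l'. ennreal (g y) \<partial>lebesgue)"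
            by (intro nn_integral_cong) (auto simp: g_def indicator_def)
          then have "avg (qcube a' l') (\<lambda>x. ennreal \<bar>f x\<bar>) =
              (\<integral>\<^sup>+y\<in>qcube a' l'. ennreal (g y) \<partial>lebesgue) / emeasure lebesgue (qcube a' l')"
            using al'(4) by (simp only: avg_qcube)
          also have "\<dots> \<le> M x"
            unfolding M_def wmax_def using al' xQ Q(1) by (intro SUP_upper2[of "(a', l')"]) auto
          finally show ?thesis .
        qed
        finally show ?thesis
          by (simp add: le_max_iff_disj mult_left_mono)
      qed
    qed
    have "(\<integral>\<^sup>+x\<in>P. enn_powr (maximal (\<lambda>x. ennreal \<bar>f x\<bar>) x) p * ennreal (w x) \<partial>lebesgue)
        \<le> (\<integral>\<^sup>+x\<in>P. (enn_powr (ennreal (2 ^ DIM('a)) * M x) p + enn_powr S p) * ennreal (w x) \<partial>lebesgue)"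
    proof (rule nn_integral_mono)
      fix x
      show "enn_powr (maximal (\<lambda>x. ennreal \<bar>f x\<bar>) x) p * ennreal (w x) * indicator P x
          \<le> (enn_powr (ennreal (2 ^ DIM('a)) * M x) p + enn_powr S p) * ennreal (w x) * indicator P x"
      proof (cases "x \<in> P")
        case True
        have "enn_powr (maximal (\<lambda>x. ennreal \<bar>f x\<bar>) x) p \<le> enn_powr (max (ennreal (2 ^ DIM('a)) * M x) S) p"
          using p_gt_1 by (intro enn_powr_mono split[OF True]) auto
        also have "\<dots> \<le> enn_powr (ennreal (2 ^ DIM('a)) * M x) p + enn_powr S p"
          by (simp add: max_def)
        finally show ?thesis by (intro mult_right_mono) auto
      qed simp
    qed
    also have "\<dots> = (\<integral>\<^sup>+x\<in>P. (enn_powr (ennreal (2 ^ DIM('a)) * M x) p + enn_powr S p) \<partial>W)"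
      by (rule set_nn_integral_W) measurable
    \<comment> \<open>The restriction to \<open>P\<close> is dropped for \<open>M\<close>, which is
      bounded over the whole space, but kept for the constant \<open>S\<close>.\<close>
    also have "\<dots> \<le> (\<integral>\<^sup>+x. enn_powr (ennreal (2 ^ DIM('a)) * M x) p + enn_powr S p * indicator P x \<partial>W)"
      by (intro nn_integral_mono) (auto simp: indicator_def)
    also have "\<dots> = (\<integral>\<^sup>+x. enn_powr (ennreal (2 ^ DIM('a)) * M x) p \<partial>W) + enn_powr S p * emeasure W P"
      by (subst nn_integral_add) (auto simp: nn_integral_cmult_indicator)
    also have "\<dots> \<le> ennreal ((2 ^ DIM('a)) powr p * (Cm * N) * v) * Xf + ennreal ((m ^ DIM('a) * C) powr p * v) * Xf"
    proof (rule add_mono)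
      have "(\<integral>\<^sup>+x. enn_powr (ennreal (2 ^ DIM('a)) * M x) p \<partial>W)
          = ennreal ((2 ^ DIM('a)) powr p) * (\<integral>\<^sup>+x. enn_powr (M x) p \<partial>W)"
        using p_gt_1 enn_powr_ennreal[of "2 ^ DIM('a)" p] by (simp add: enn_powr_mult nn_integral_cmult)
      also have "(\<integral>\<^sup>+x. enn_powr (M x) p \<partial>W) \<le> ennreal Cm * (\<integral>\<^sup>+x. enn_powr (ennreal (g x)) p \<partial>W)"
        unfolding M_def
      proof (rule muck[OF J, where B = "k * (r2 + 1) / 2"])
        fix a l assume al: "(a, l) \<in> J"
        have l: "0 < l" "\<Lambda> * l \<le> infdist a \<Omega>" using al by (auto simp: J_def small_cubes_def)
        have "(2 * r1 + 1) * (s * (5 * (s * l))) = \<Lambda> * l"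
          by (simp add: \<Lambda>_def mult_ac)
        then have 1: "(2 * r1 + 1) * (s * (5 * (s * l))) \<le> infdist a \<Omega>" using l(2) by linarith
        have "1 * l \<le> 5 * s * l" using s_ge_1 l by (intro mult_right_mono) auto
        then have "(2 * r1 + 1) * (s * l) \<le> (2 * r1 + 1) * (s * (5 * (s * l)))"
          using r s_ge_1 by (intro mult_left_mono) auto
        with 1 have 2: "(2 * r1 + 1) * (s * l) \<le> infdist a \<Omega>" by linarith
        have C0: "0 \<le> C" using C by simp
        have l5: "0 < 5 * (s * l)" using l s_ge_1 by simp
        show "0 < l \<and> l \<le> k * (r2 + 1) / 2 \<and> Ap_on c (qcube a l) \<and>
            Ap_on c (qcube a (5 * (s * l))) \<and> emeasure W (qcube a (5 * (s * l))) \<noteq> top"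
          using l small_cubesD(1)[OF P k] al local_Ap[OF A C0 l(1) 2] local_Ap[OF A C0 l5 1] W_qcube_finite
          by (auto simp: J_def Pbk c_def \<theta>_def)
      qed (auto simp: g_def)
      also have "(\<integral>\<^sup>+x. enn_powr (ennreal (g x)) p \<partial>W) = (\<integral>\<^sup>+x\<in>star b k. enn_powr (ennreal \<bar>f x\<bar>) p \<partial>W)"
        by (intro nn_integral_cong) (auto simp: g_def indicator_def)
      also have "\<dots> \<le> ennreal (N * v) * Xf"
        unfolding Xf_def v_def Pbk by (rule star[OF P k]) measurable
      finally have "(\<integral>\<^sup>+x. enn_powr (ennreal (2 ^ DIM('a)) * M x) p \<partial>W)
          \<le> ennreal ((2 ^ DIM('a)) powr p) * (ennreal Cm * (ennreal (N * v) * Xf))"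
        by this (auto intro!: mult_left_mono)
      also have "\<dots> = (ennreal ((2 ^ DIM('a)) powr p) * ennreal Cm * ennreal (N * v)) * Xf"
        by (simp only: mult_ac)
      also have "ennreal ((2 ^ DIM('a)) powr p) * ennreal Cm * ennreal (N * v) = ennreal ((2 ^ DIM('a)) powr p * (Cm * N) * v)"
        using Cm N v by (simp add: mult_ac flip: ennreal_mult)
      finally show "(\<integral>\<^sup>+x. enn_powr (ennreal (2 ^ DIM('a)) * M x) p \<partial>W)
          \<le> ennreal ((2 ^ DIM('a)) powr p * (Cm * N) * v) * Xf" .
    next
      have "enn_powr S p * emeasure W P =
          (SUP (a, l)\<in>Lg. enn_powr (avg (qcube a l) (\<lambda>x. ennreal \<bar>f x\<bar>)) p * emeasure W P)"
        using p_gt_1 by (simp add: S_def enn_powr_SUP SUP_mult_right_ennreal split_beta)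
      also have "\<dots> \<le> ennreal ((m ^ DIM('a) * C) powr p * v) * Xf"
      proof (rule SUP_least, clarify)
        fix a l assume "(a, l) \<in> Lg"
        then obtain x where x: "x \<in> qcube a l" "x \<in> qcube b k" and l: "0 < l" "infdist a \<Omega> \<le> L * l"
          by (auto simp: Lg_def Pbk)
        show "enn_powr (avg (qcube a l) (\<lambda>x. ennreal \<bar>f x\<bar>)) p * emeasure W P \<le> ennreal ((m ^ DIM('a) * C) powr p * v) * Xf"
          unfolding Pbk v_def Xf_def m_def using C
          by (intro avg_large_cube_le[OF A _ P k x l L]) auto
      qed
      finally show "enn_powr S p * emeasure W P \<le> ennreal ((m ^ DIM('a) * C) powr p * v) * Xf" .
    qed
    also have "\<dots> = (ennreal ((2 ^ DIM('a)) powr p * (Cm * N) * v) + ennreal ((m ^ DIM('a) * C) powr p * v)) * Xf"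
      by (rule distrib_right[symmetric])
    also have "ennreal ((2 ^ DIM('a)) powr p * (Cm * N) * v) + ennreal ((m ^ DIM('a) * C) powr p * v) = ennreal (K * v)"
      using Cm N v by (subst ennreal_plus[symmetric]) (auto simp: K_def distrib_right)
    finally show ?thesis by (simp add: v_def Xf_def)
  qed
  have "X (maximal (\<lambda>x. ennreal \<bar>f x\<bar>)) \<le> ennreal (K powr (1 / p)) * X (\<lambda>x. ennreal \<bar>f x\<bar>)"
    if f: "f \<in> borel_measurable lebesgue" for f
    unfolding morrey_norm_def[of _ _ _ _ "maximal _"]
  proof (rule SUP_least)
    fix P assume P: "P \<in> F"
    then obtain b k where bk: "P = qcube b k" "0 < k" by (rule whitney_familyE)
    define v where "v = measure lebesgue P powr lam"
    have v: "0 < v" using bk measure_qcube[of k b] by (simp add: v_def)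
    have "ennreal (1 / v) * (\<integral>\<^sup>+x\<in>P. enn_powr (maximal (\<lambda>x. ennreal \<bar>f x\<bar>) x) p * ennreal (w x) \<partial>lebesgue)
        \<le> ennreal (1 / v) * (ennreal (K * v) * enn_powr (X (\<lambda>x. ennreal \<bar>f x\<bar>)) p)"
      unfolding v_def by (intro mult_left_mono main f P) auto
    also have "\<dots> = ennreal K * enn_powr (X (\<lambda>x. ennreal \<bar>f x\<bar>)) p"
      using v K by (simp add: mult.assoc[symmetric] ennreal_mult[symmetric])
    finally have "enn_powr (ennreal (1 / v) * (\<integral>\<^sup>+x\<in>P. enn_powr (maximal (\<lambda>x. ennreal \<bar>f x\<bar>) x) p * ennreal (w x) \<partial>lebesgue)) (1 / p)
        \<le> enn_powr (ennreal K * enn_powr (X (\<lambda>x. ennreal \<bar>f x\<bar>)) p) (1 / p)"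
      using p_gt_1 by (intro enn_powr_mono) auto
    also have "\<dots> = ennreal (K powr (1 / p)) * X (\<lambda>x. ennreal \<bar>f x\<bar>)"
      using p_gt_1 K by (simp add: enn_powr_mult enn_powr_powr enn_powr_ennreal)
    finally show "enn_powr (ennreal (1 / measure lebesgue P powr lam) *
        (\<integral>\<^sup>+x\<in>P. enn_powr (maximal (\<lambda>x. ennreal \<bar>f x\<bar>) x) p * ennreal (w x) \<partial>lebesgue)) (1 / p)
      \<le> ennreal (K powr (1 / p)) * X (\<lambda>x. ennreal \<bar>f x\<bar>)"
      by (simp add: v_def)
  qed
  moreover have "0 < K powr (1 / p)" using K by simp
  ultimately show ?thesis
    unfolding maximal_bounded_def by blast
qed

end

theorem theorem1p3:
  fixes w :: "'a::euclidean_space \<Rightarrow> real" and \<Omega> :: "'a set"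
    and p lam r1 r2 :: real
  assumes "0 < lam" "lam < 1" "p > 1"
    and "\<forall>x. 0 \<le> w x" "locally_integrable w"
    and "closed \<Omega>" "\<Omega> \<noteq> {}"
    and "0 < r1" "r1 < r2"
  shows "maximal_bounded p lam (whitney_family \<Omega> r1 r2) w
           \<longleftrightarrow> A_morrey p lam (whitney_family \<Omega> r1 r2) w"
proof
  have w: "w \<in> borel_measurable lebesgue"
    by (rule locally_integrable_measurable) fact
  interpret whitney w p \<Omega> r1 r2 lam "sqrt (real DIM('a))"
    "5 * (sqrt (real DIM('a)) * ((2 * r1 + 1) * sqrt (real DIM('a))))"
    by unfold_locales (use assms w in auto)
  have F: "whitney_family \<Omega> r1 r2 \<subseteq> sets lebesgue"
    by (auto elim: whitney_familyE)
  show "A_morrey p lam (whitney_family \<Omega> r1 r2) w"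
    if "maximal_bounded p lam (whitney_family \<Omega> r1 r2) w"
    using maximal_bounded_imp_A_morrey[OF _ w F that] \<open>p > 1\<close> by simp
  show "maximal_bounded p lam (whitney_family \<Omega> r1 r2) w"
    if "A_morrey p lam (whitney_family \<Omega> r1 r2) w"
    using A_morrey_imp_maximal_bounded that by simp
qed

end
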